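(* Let $(M_p)_{p\in\mathbb N}$ be a sequence of positive reals with $M_0=1$ satisfying $(M.1)$ and $(M.2)$, and let $\ast$ be either $(M_p)$, in which case assume $1\prec M_p$, or $\{M_p\}$, in which case assume $1\subset M_p$. Let $(\varphi_n)_{n\in\mathbb N}$ be a mollifier sequence with $r=1$ and let $\iota:\mathcal E_{2\pi}'^\ast\to\mathcal G_{2\pi}^\ast$, $\iota(f)=[(f\ast\varphi_n)_n]$, be the associated embedding. Then $$\mathcal G_{2\pi}^{\ast,\infty}\cap\iota(\mathcal E_{2\pi}'^\ast)=\iota(\mathcal E_{2\pi}^\ast).$$
   Context: $\mathbb N=\{0,1,2,\dots\}$, $D=-i\,d/dt$. Conditions on $(M_p)$: $(M.1)$: $M_p^2\le M_{p-1}M_{p+1}$ for $p\ge1$; $(M.2)$: there are $A,H\ge1$ with $M_{p+q}\le AH^{p+q}M_pM_q$ for all $p,q\in\mathbb N$. $1\subset M_p$ means: there are $C,h>0$ with $1\le Ch^pM_p$ for all $p$; $1\prec M_p$ means: for every $h>0$ there is $C>0$ with $1\le Ch^pM_p$ for all $p$. Associated function: $M(t)=\sup_{p\in\mathbb N}\log(t^p/M_p)$ for $t>0$, $M(0)=0$, $M(t)=M(|t|)$. (In the Roumieu case $M$ may take the value $+\infty$; then $e^{-\infty}=0$, and $0\cdot\infty=0$.) For $h>0$, $\mathcal E_{2\pi}^{M_p,h}$ is the Banach space of smooth $2\pi$-periodic $\varphi:\mathbb R\to\mathbb C$ with $\|\varphi\|_h=\sup_{p} h^p\|D^p\varphi\|_{L^\infty(\mathbb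 R)}/M_p<\infty$. $\mathcal E_{2\pi}^{(M_p)}=\varprojlim_{h\to\infty}\mathcal E_{2\pi}^{M_p,h}$ (intersection over all $h$) and $\mathcal E_{2\pi}^{\{M_p\}}=\varinjlim_{h\to0^+}\mathcal E_{2\pi}^{M_p,h}$ (union over all $h$, locally convex inductive limit). $\mathcal E_{2\pi}'^\ast$ is the dual of $\mathcal E_{2\pi}^\ast$; $\mathcal E_{2\pi}^\ast\subset\mathcal E_{2\pi}'^\ast$ via $\langle f,\varphi\rangle=\int_0^{2\pi}f\varphi\,dt$. For $f\in\mathcal E_{2\pi}'^\ast$, $g\in\mathcal E_{2\pi}^\ast$: $(f\ast g)(t)=\langle f(u),g(t-u)\rangle$. Fourier coefficients of a function: $\widehat\varphi(k)=\frac1{2\pi}\int_0^{2\pi}\varphi(t)e^{-ikt}dt$. Moderate sequences: $\mathcal E_{2\pi,\mathcal M}^{(M_p)}$ is the set of $(f_n)_n\in(\mathcal E_{2\pi}^{(M_p)})^{\mathbb N}$ such that $\forall h>0\,\exists\lambda>0:\ \sup_n\|f_n\|_he^{-M(\lambda n)}<\infty$; $\mathcal E_{2\pi,\mathcal M}^{\{M_p\}}$ is the set of $(f_n)_n\in(\mathcal E_{2\pi}^{\{M_p\}})^{\mathbb N}$ such that $\forall\lambda>0\,\exists h>0:\ \sup_n\|f_n\|_he^{-M(\lambda n)}<\infty$. Negligible sequences: $\mathcal E_{2\pi,\mathcal N}^{(M_p)}$: $\forall h>0\,\forall\lambda>0:\ \sup_n\|f_n\|_he^{M(\lambda n)}<\infty$;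 $\mathcal E_{2\pi,\mathcal N}^{\{M_p\}}$: $\exists\lambda>0\,\exists h>0:\ \sup_n\|f_n\|_he^{M(\lambda n)}<\infty$. $\mathcal G_{2\pi}^\ast=\mathcal E_{2\pi,\mathcal M}^\ast/\mathcal E_{2\pi,\mathcal N}^\ast$ (algebra modulo ideal, termwise operations), with classes written $[(f_n)_n]$. Regular sequences: $\mathcal E_{2\pi,\mathcal M}^{(M_p),\infty}$ is the set of $(f_n)_n\in(\mathcal E_{2\pi}^{(M_p)})^{\mathbb N}$ with $\exists\lambda>0\,\forall h>0:\ \sup_n\|f_n\|_he^{-M(\lambda n)}<\infty$; $\mathcal E_{2\pi,\mathcal M}^{\{M_p\},\infty}$ is the set of $(f_n)_n\in(\mathcal E_{2\pi}^{\{M_p\}})^{\mathbb N}$ with $\exists h>0\,\forall\lambda>0:\ \sup_n\|f_n\|_he^{-M(\lambda n)}<\infty$. The algebra of regular periodic generalized functions is $\mathcal G_{2\pi}^{\ast,\infty}=\mathcal E_{2\pi,\mathcal M}^{\ast,\infty}/\mathcal E_{2\pi,\mathcal N}^\ast\subset\mathcal G_{2\pi}^\ast$. Mollifier sequence with $r=1$: a sequence $(\varphi_n)_{n\in\mathbb N}$ of smooth $2\pi$-periodic functions whose Fourier coefficients $c_{k,n}=\widehat\varphi_n(k)$ satisfy: there is $C>0$ with $|c_{k,n}|\le C$ for all $k\in\mathbb Z,n\in\mathbb N$; there is $R>0$ such that for all $n$, $c_{k,n}=0$ whenever $|k|>Rn$; for all $n$, $c_{k,n}=\frac1{2\pi}$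 whenever $|k|\le n$. For such a sequence $\iota$ is a well-defined injective linear map. *)

theory Defs
  imports "HOL-Probability.Probability" "HOL-Algebra.QuotRing"
begin

section \<open>Weight sequences\<close>

definition M1 :: "(nat \<Rightarrow> real) \<Rightarrow> bool" where
  "M1 M \<longleftrightarrow> (\<forall>p\<ge>1. (M p)\<^sup>2 \<le> M (p - 1) * M (p + 1))"

definition M2 :: "(nat \<Rightarrow> real) \<Rightarrow> bool" where
  "M2 M \<longleftrightarrow> (\<exists>A\<ge>1. \<exists>H\<ge>1. \<forall>p q. M (p + q) \<le> A * H ^ (p + q) * M p * M q)"

definition one_subset :: "(nat \<Rightarrow> real) \<Rightarrow> bool" where
  "one_subset M \<longleftrightarrow> (\<exists>C>0. \<exists>h>0. \<forall>p. 1 \<le> C * h ^ p * M p)"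

definition one_prec :: "(nat \<Rightarrow> real) \<Rightarrow> bool" where
  "one_prec M \<longleftrightarrow> (\<forall>h>0. \<exists>C>0. \<forall>p. 1 \<le> C * h ^ p * M p)"

definition assoc :: "(nat \<Rightarrow> real) \<Rightarrow> real \<Rightarrow> ereal" where
  "assoc M t = (if t = 0 then 0 else SUP p. ereal (ln (\<bar>t\<bar> ^ p / M p)))"

fun eexp :: "ereal \<Rightarrow> ennreal" where
  "eexp (ereal x) = ennreal (exp x)"
| "eexp PInfty = \<infinity>"
| "eexp MInfty = 0"

section \<open>Periodic ultradifferentiable functions\<close>

definition Dop :: "(real \<Rightarrow> complex) \<Rightarrow> real \<Rightarrow> complex" where
  "Dop \<phi> = (\<lambda>t. - \<i> * vector_derivative \<phi> (at t))"

definition smooth_periodic :: "(real \<Rightarrow> complex) \<Rightarrow> bool" where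
  "smooth_periodic \<phi> \<longleftrightarrow>
     (\<forall>p. (Dop ^^ p) \<phi> differentiable_on UNIV) \<and> (\<forall>t. \<phi> (t + 2 * pi) = \<phi> t)"

definition Linf_norm :: "(real \<Rightarrow> complex) \<Rightarrow> ennreal" where
  "Linf_norm \<phi> = esssup lborel (\<lambda>t. ennreal (cmod (\<phi> t)))"

text \<open>The arithmetic of \<^typ>\<open>ennreal\<close> satisfies \<open>0 * \<infinity> = 0\<close>, which is the convention needed
  below for weights that vanish or are infinite.\<close>

definition unorm :: "(nat \<Rightarrow> real) \<Rightarrow> real \<Rightarrow> (real \<Rightarrow> complex) \<Rightarrow> ennreal" where
  "unorm M h \<phi> = (SUP p. ennreal (h ^ p) * Linf_norm ((Dop ^^ p) \<phi>) / ennreal (M p))"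

definition E_step :: "(nat \<Rightarrow> real) \<Rightarrow> real \<Rightarrow> (real \<Rightarrow> complex) set" where
  "E_step M h = {\<phi>. smooth_periodic \<phi> \<and> unorm M h \<phi> < \<infinity>}"

datatype kind = Beurling | Roumieu

fun E_space :: "kind \<Rightarrow> (nat \<Rightarrow> real) \<Rightarrow> (real \<Rightarrow> complex) set" where
  "E_space Beurling M = (\<Inter>h\<in>{0<..}. E_step M h)"
| "E_space Roumieu M = (\<Union>h\<in>{0<..}. E_step M h)"

section \<open>Topologies and duals\<close>

definition step_topology :: "(nat \<Rightarrow> real) \<Rightarrow> real \<Rightarrow> (real \<Rightarrow> complex) topology" where
  "step_topology M h = topology (\<lambda>U. U \<subseteq> E_step M h \<and>
     (\<forall>\<phi>\<in>U. \<exists>\<epsilon>>0. \<forall>\<psi>\<in>E_step M h. unorm M h (\<lambda>t. \<psi> t - \<phi> t) < ennreal \<epsilon> \<longrightarrow> \<psi> \<in> U))"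

definition abs_convex :: "(real \<Rightarrow> complex) set \<Rightarrow> bool" where
  "abs_convex V \<longleftrightarrow> (\<forall>\<phi>\<in>V. \<forall>\<psi>\<in>V. \<forall>a b :: complex.
     cmod a + cmod b \<le> 1 \<longrightarrow> (\<lambda>t. a * \<phi> t + b * \<psi> t) \<in> V)"

text \<open>Beurling case: the initial (projective limit) topology for the inclusions into the steps.
  Roumieu case: the finest locally convex topology making the inclusions of the steps continuous,
  given by its usual base at 0, the absolutely convex sets that meet every step in a
  neighbourhood of 0.\<close>

fun E_topology :: "kind \<Rightarrow> (nat \<Rightarrow> real) \<Rightarrow> (real \<Rightarrow> complex) topology" where
  "E_topology Beurling M = topology_generated_by
     {E_space Beurling M \<inter> U | U h. h > 0 \<and> openin (step_topology M h) U}"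
| "E_topology Roumieu M = topology (\<lambda>U. U \<subseteq> E_space Roumieu M \<and>
     (\<forall>\<phi>\<in>U. \<exists>V \<subseteq> E_space Roumieu M. abs_convex V \<and>
        (\<forall>h>0. \<exists>W. openin (step_topology M h) W \<and> (\<lambda>t. 0) \<in> W \<and> W \<subseteq> V) \<and>
        (\<forall>\<psi>\<in>V. (\<lambda>t. \<phi> t + \<psi> t) \<in> U)))"

lemma openin_step_topology:
  "openin (step_topology M h) U \<longleftrightarrow> U \<subseteq> E_step M h \<and>
     (\<forall>\<phi>\<in>U. \<exists>\<epsilon>>0. \<forall>\<psi>\<in>E_step M h. unorm M h (\<lambda>t. \<psi> t - \<phi> t) < ennreal \<epsilon> \<longrightarrow> \<psi> \<in> U)"
  (is "_ \<longleftrightarrow> ?P U")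
proof -
  have "?P (S \<inter> T)" if S: "?P S" and T: "?P T" for S T
  proof (intro conjI ballI)
    fix \<phi> assume "\<phi> \<in> S \<inter> T"
    then obtain a b where a: "a > 0" "\<forall>\<psi>\<in>E_step M h. unorm M h (\<lambda>t. \<psi> t - \<phi> t) < ennreal a \<longrightarrow> \<psi> \<in> S"
      and b: "b > 0" "\<forall>\<psi>\<in>E_step M h. unorm M h (\<lambda>t. \<psi> t - \<phi> t) < ennreal b \<longrightarrow> \<psi> \<in> T"
      using S T by blast
    have "x < ennreal a \<and> x < ennreal b" if "x < ennreal (min a b)" for x
      using that by (meson ennreal_leI less_le_trans min.cobounded1 min.cobounded2)
    then show "\<exists>\<epsilon>>0. \<forall>\<psi>\<in>E_step M h. unorm M h (\<lambda>t. \<psi> t - \<phi> t) < ennreal \<epsilon> \<longrightarrow> \<psi> \<in> S \<inter> T"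
      using a b by (intro exI[of _ "min a b"]) auto
  qed (use S in blast)
  moreover have "?P (\<Union>\<K>)" if K: "\<forall>K\<in>\<K>. ?P K" for \<K>
  proof (intro conjI ballI)
    fix \<phi> assume "\<phi> \<in> \<Union>\<K>"
    then obtain K where K': "K \<in> \<K>" "\<phi> \<in> K" by blast
    then obtain e where "e > 0" "\<forall>\<psi>\<in>E_step M h. unorm M h (\<lambda>t. \<psi> t - \<phi> t) < ennreal e \<longrightarrow> \<psi> \<in> K"
      using K by blast
    with K' show "\<exists>\<epsilon>>0. \<forall>\<psi>\<in>E_step M h. unorm M h (\<lambda>t. \<psi> t - \<phi> t) < ennreal \<epsilon> \<longrightarrow> \<psi> \<in> \<Union>\<K>"
      by blast
  qed (use K in blast)
  ultimately have "istopology ?P"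
    unfolding istopology_def by blast
  then show ?thesis
    by (simp add: step_topology_def topology_inverse')
qed

lemma openin_E_topology_Roumieu:
  "openin (E_topology Roumieu M) U \<longleftrightarrow> U \<subseteq> E_space Roumieu M \<and>
     (\<forall>\<phi>\<in>U. \<exists>V \<subseteq> E_space Roumieu M. abs_convex V \<and>
        (\<forall>h>0. \<exists>W. openin (step_topology M h) W \<and> (\<lambda>t. 0) \<in> W \<and> W \<subseteq> V) \<and>
        (\<forall>\<psi>\<in>V. (\<lambda>t. \<phi> t + \<psi> t) \<in> U))"
proof -
  define E where "E = E_space Roumieu M"
  define N where "N V \<longleftrightarrow> V \<subseteq> E \<and> abs_convex V \<and>
        (\<forall>h>0. \<exists>W. openin (step_topology M h) W \<and> (\<lambda>t. 0) \<in> W \<and> W \<subseteq> V)" for V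
  let ?P = "\<lambda>U. U \<subseteq> E \<and> (\<forall>\<phi>\<in>U. \<exists>V. N V \<and> (\<forall>\<psi>\<in>V. (\<lambda>t. \<phi> t + \<psi> t) \<in> U))"
  have NI: "N (V \<inter> V')" if V: "N V" and V': "N V'" for V V'
    unfolding N_def
  proof (intro conjI allI impI)
    show "V \<inter> V' \<subseteq> E" using V N_def by blast
    show "abs_convex (V \<inter> V')" using V V' unfolding N_def abs_convex_def by blast
    fix h :: real assume "h > 0"
    then obtain W W' where "openin (step_topology M h) W" "(\<lambda>t. 0) \<in> W" "W \<subseteq> V"
       "openin (step_topology M h) W'" "(\<lambda>t. 0) \<in> W'" "W' \<subseteq> V'"
      using V V' unfolding N_def by metis
    then show "\<exists>W. openin (step_topology M h) W \<and> (\<lambda>t. 0) \<in> W \<and> W \<subseteq> V \<inter> V'"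
      by (intro exI[of _ "W \<inter> W'"]) auto
  qed
  have "?P (S \<inter> T)" if S: "?P S" and T: "?P T" for S T
  proof (intro conjI ballI)
    fix \<phi> assume "\<phi> \<in> S \<inter> T"
    then obtain V V' where "N V" "\<forall>\<psi>\<in>V. (\<lambda>t. \<phi> t + \<psi> t) \<in> S"
      and "N V'" "\<forall>\<psi>\<in>V'. (\<lambda>t. \<phi> t + \<psi> t) \<in> T"
      using S T by blast
    with NI show "\<exists>V. N V \<and> (\<forall>\<psi>\<in>V. (\<lambda>t. \<phi> t + \<psi> t) \<in> S \<inter> T)"
      by (intro exI[of _ "V \<inter> V'"]) auto
  qed (use S in blast)
  moreover have "?P (\<Union>\<K>)" if K: "\<forall>K\<in>\<K>. ?P K" for \<K>
  proof (intro conjI ballI)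
    fix \<phi> assume "\<phi> \<in> \<Union>\<K>"
    then obtain K where K': "K \<in> \<K>" "\<phi> \<in> K" by blast
    then obtain V where "N V" "\<forall>\<psi>\<in>V. (\<lambda>t. \<phi> t + \<psi> t) \<in> K"
      using K by blast
    with K' show "\<exists>V. N V \<and> (\<forall>\<psi>\<in>V. (\<lambda>t. \<phi> t + \<psi> t) \<in> \<Union>\<K>)"
      by blast
  qed (use K in blast)
  ultimately have "istopology ?P"
    unfolding istopology_def by blast
  then have "openin (topology ?P) U \<longleftrightarrow> ?P U"
    by (rule topology_inverse'[THEN fun_cong])
  then show ?thesis
    by (simp only: E_topology.simps N_def E_def conj_assoc)
qed

text \<open>Functionals are normalised to \<^const>\<open>undefined\<close> off the space, so that an element of the
  dual is determined by its values on the space.\<close>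

definition E_dual :: "kind \<Rightarrow> (nat \<Rightarrow> real) \<Rightarrow> ((real \<Rightarrow> complex) \<Rightarrow> complex) set" where
  "E_dual s M = {f \<in> extensional (E_space s M).
     (\<forall>\<phi>\<in>E_space s M. \<forall>\<psi>\<in>E_space s M. \<forall>a b.
        f (\<lambda>t. a * \<phi> t + b * \<psi> t) = a * f \<phi> + b * f \<psi>) \<and>
     continuous_map (E_topology s M) euclidean f}"

definition functional_of ::
    "kind \<Rightarrow> (nat \<Rightarrow> real) \<Rightarrow> (real \<Rightarrow> complex) \<Rightarrow> (real \<Rightarrow> complex) \<Rightarrow> complex" where
  "functional_of s M f = (\<lambda>\<phi>\<in>E_space s M. integral {0..2 * pi} (\<lambda>t. f t * \<phi> t))"

definition conv :: "((real \<Rightarrow> complex) \<Rightarrow> complex) \<Rightarrow> (real \<Rightarrow> complex) \<Rightarrow> real \<Rightarrow> complex" where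
  "conv f g = (\<lambda>t. f (\<lambda>u. g (t - u)))"

definition fourier_coeff :: "(real \<Rightarrow> complex) \<Rightarrow> int \<Rightarrow> complex" where
  "fourier_coeff \<phi> k =
     1 / (2 * pi) * integral {0..2 * pi} (\<lambda>t. \<phi> t * exp (- \<i> * of_int k * of_real t))"

section \<open>Generalized functions\<close>

fun moderate :: "kind \<Rightarrow> (nat \<Rightarrow> real) \<Rightarrow> (nat \<Rightarrow> real \<Rightarrow> complex) set" where
  "moderate Beurling M = {f. (\<forall>n. f n \<in> E_space Beurling M) \<and>
     (\<forall>h>0. \<exists>\<mu>>0. (SUP n. unorm M h (f n) * eexp (- assoc M (\<mu> * real n))) < \<infinity>)}"
| "moderate Roumieu M = {f. (\<forall>n. f n \<in> E_space Roumieu M) \<and>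
     (\<forall>\<mu>>0. \<exists>h>0. (SUP n. unorm M h (f n) * eexp (- assoc M (\<mu> * real n))) < \<infinity>)}"

fun negligible_seqs :: "kind \<Rightarrow> (nat \<Rightarrow> real) \<Rightarrow> (nat \<Rightarrow> real \<Rightarrow> complex) set" where
  "negligible_seqs Beurling M = {f. (\<forall>n. f n \<in> E_space Beurling M) \<and>
     (\<forall>h>0. \<forall>\<mu>>0. (SUP n. unorm M h (f n) * eexp (assoc M (\<mu> * real n))) < \<infinity>)}"
| "negligible_seqs Roumieu M = {f. (\<forall>n. f n \<in> E_space Roumieu M) \<and>
     (\<exists>\<mu>>0. \<exists>h>0. (SUP n. unorm M h (f n) * eexp (assoc M (\<mu> * real n))) < \<infinity>)}"

fun regular_seqs :: "kind \<Rightarrow> (nat \<Rightarrow> real) \<Rightarrow> (nat \<Rightarrow> real \<Rightarrow> complex) set" where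
  "regular_seqs Beurling M = {f. (\<forall>n. f n \<in> E_space Beurling M) \<and>
     (\<exists>\<mu>>0. \<forall>h>0. (SUP n. unorm M h (f n) * eexp (- assoc M (\<mu> * real n))) < \<infinity>)}"
| "regular_seqs Roumieu M = {f. (\<forall>n. f n \<in> E_space Roumieu M) \<and>
     (\<exists>h>0. \<forall>\<mu>>0. (SUP n. unorm M h (f n) * eexp (- assoc M (\<mu> * real n))) < \<infinity>)}"

definition seq_ring :: "(nat \<Rightarrow> real \<Rightarrow> complex) set \<Rightarrow> (nat \<Rightarrow> real \<Rightarrow> complex) ring" where
  "seq_ring A = \<lparr>carrier = A, mult = (\<lambda>f g n t. f n t * g n t), one = (\<lambda>n t. 1),
     zero = (\<lambda>n t. 0), add = (\<lambda>f g n t. f n t + g n t)\<rparr>"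

text \<open>The coset of a regular sequence does not depend on which of the two rings it is formed in,
  so \<open>carrier (GA_reg s M)\<close> is literally a subset of \<open>carrier (GA s M)\<close>.\<close>

definition GA :: "kind \<Rightarrow> (nat \<Rightarrow> real) \<Rightarrow> (nat \<Rightarrow> real \<Rightarrow> complex) set ring" where
  "GA s M = seq_ring (moderate s M) Quot negligible_seqs s M"

definition GA_reg :: "kind \<Rightarrow> (nat \<Rightarrow> real) \<Rightarrow> (nat \<Rightarrow> real \<Rightarrow> complex) set ring" where
  "GA_reg s M = seq_ring (regular_seqs s M) Quot negligible_seqs s M"

definition GA_class ::
    "kind \<Rightarrow> (nat \<Rightarrow> real) \<Rightarrow> (nat \<Rightarrow> real \<Rightarrow> complex) \<Rightarrow> (nat \<Rightarrow> real \<Rightarrow> complex) set" where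
  "GA_class s M f = negligible_seqs s M +>\<^bsub>seq_ring (moderate s M)\<^esub> f"

definition mollifier :: "(nat \<Rightarrow> real \<Rightarrow> complex) \<Rightarrow> bool" where
  "mollifier \<phi> \<longleftrightarrow> (\<forall>n. smooth_periodic (\<phi> n)) \<and>
     (\<exists>C>0. \<forall>k n. cmod (fourier_coeff (\<phi> n) k) \<le> C) \<and>
     (\<exists>R>0. \<forall>n k. real_of_int \<bar>k\<bar> > R * real n \<longrightarrow> fourier_coeff (\<phi> n) k = 0) \<and>
     (\<forall>n k. \<bar>k\<bar> \<le> int n \<longrightarrow> fourier_coeff (\<phi> n) k = 1 / (2 * pi))"

definition \<iota> :: "kind \<Rightarrow> (nat \<Rightarrow> real) \<Rightarrow> (nat \<Rightarrow> real \<Rightarrow> complex) \<Rightarrow>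
    ((real \<Rightarrow> complex) \<Rightarrow> complex) \<Rightarrow> (nat \<Rightarrow> real \<Rightarrow> complex) set" where
  "\<iota> s M \<phi> f = GA_class s M (\<lambda>n. conv f (\<phi> n))"

end

theory Submission
  imports Defs
begin

text \<open>Only the Fourier coefficients matter: each \<open>\<phi> n\<close> is a trigonometric polynomial, so \<open>f * \<phi> n\<close> depends
  on \<open>f\<close> only through its values \<open>b k\<close> on the exponentials, and its \<open>k\<close>-th coefficient is \<open>b k / (2 * pi)\<close>
  as soon as \<open>\<bar>k\<bar> \<le> n\<close>. If \<open>f * \<phi> n\<close> is regular up to a negligible sequence, taking \<open>n = \<bar>k\<bar>\<close> bounds
  \<open>\<bar>b k\<bar>\<close> by \<open>exp (M (\<mu> k) - M (h k))\<close>, and (M.2) turns this into the decay that characterises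
  the coefficients of functions in the space; summing the series gives an \<open>F\<close> with the same
  convolutions as \<open>f\<close>. Conversely such decay bounds \<open>F * \<phi> n\<close> uniformly in \<open>n\<close>, because the
  coefficients of \<open>\<phi> n\<close> are uniformly bounded.\<close>

section \<open>Trigonometric series with rapidly decreasing coefficients\<close>

text \<open>In the Roumieu case \<open>assoc M\<close> may be infinite, so decay of coefficients is
  never phrased through \<open>exp (- assoc M (h * k))\<close> but as the inequalities |b k| (h
  |k|)^q <= C M q for all q. Where \<open>assoc M\<close> is infinite the regularity estimate is
  void; vanishing of b k then comes from the membership of the single function f * \<phi> n in one
  step space. The passage between functions and coefficients is asymmetric. A bound on derivatives
  gives coefficient decay at the same scale h, whereas summing a series costs two extra powers of k,
  and (M.2) pays for them by replacing h with h / H. The growth permitted to a regular sequence is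
  absorbed at the same price. Both losses are harmless, since the scale is quantified universally
  (Beurling) or existentially (Roumieu). A negligible correction enters through a uniform bound,
  because its weights are at least 1. A mollifier is given by its Fourier coefficients alone, so
  recovering \<phi> n as a trigonometric polynomial requires the uniqueness theorem for Fourier
  coefficients, derived here from Stone-Weierstrass.\<close>

definition fexp :: "int \<Rightarrow> real \<Rightarrow> complex" where
  "fexp k t = exp (\<i> * of_int k * of_real t)"

lemma norm_fexp [simp]: "cmod (fexp k t) = 1"
  by (simp add: fexp_def)

lemma fexp_add: "fexp (k + l) t = fexp k t * fexp l t"
  by (simp add: fexp_def exp_add[symmetric] algebra_simps)

lemma fexp_diff: "fexp k (t - u) = fexp k t * fexp (- k) u"
  by (simp add: fexp_def exp_add[symmetric] algebra_simps)

lemma fexp_0 [simp]: "fexp 0 t = 1"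
  by (simp add: fexp_def)

lemma fexp_2pi [simp]: "fexp k (2 * pi) = 1" "fexp k 0 = 1"
proof -
  have "exp (2 * of_real pi * \<i> * of_int k) = (1 :: complex)"
    by (simp add: exp_eq_1 mult.assoc)
  then show "fexp k (2 * pi) = 1" "fexp k 0 = 1"
    by (simp_all add: fexp_def mult_ac)
qed

lemma fexp_periodic: "fexp k (t + 2 * pi) = fexp k t"
proof -
  have "fexp k (t + 2 * pi) = fexp k t * fexp k (2 * pi)"
    by (simp add: fexp_def exp_add[symmetric] algebra_simps del: fexp_2pi)
  then show ?thesis by simp
qed

lemma fexp_has_vector_derivative:
  "(fexp k has_vector_derivative \<i> * of_int k * fexp k t) (at t within S)"
proof -
  have "((\<lambda>z. exp (\<i> * of_int k * z)) has_field_derivative \<i> * of_int k * fexp k t) (at (of_real t))"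
    by (auto intro!: derivative_eq_intros simp: fexp_def)
  from has_vector_derivative_real_field[OF this] show ?thesis
    by (simp add: fexp_def[abs_def])
qed

lemma continuous_on_fexp [continuous_intros]: "continuous_on S (fexp k)"
  unfolding fexp_def by (intro continuous_intros)

lemma has_integral_fexp: "(fexp k has_integral (if k = 0 then of_real (2 * pi) else 0)) {0..2 * pi}"
proof (cases "k = 0")
  case True
  have "fexp 0 = (\<lambda>t. 1)" by auto
  then show ?thesis
    using True has_integral_const_real[of "1::complex" 0 "2 * pi"] by (simp add: scaleR_conv_of_real)
next
  case False
  have "((\<lambda>t. fexp k t) has_integral fexp k (2 * pi) / (\<i> * of_int k) - fexp k 0 / (\<i> * of_int k)) {0..2 * pi}"
  proof (rule fundamental_theorem_of_calculus)
    fix t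
    have "((\<lambda>t. fexp k t / (\<i> * of_int k)) has_vector_derivative \<i> * of_int k * fexp k t / (\<i> * of_int k))
        (at t within {0..2 * pi})"
      by (intro derivative_intros fexp_has_vector_derivative)
    with False show "((\<lambda>t. fexp k t / (\<i> * of_int k)) has_vector_derivative fexp k t) (at t within {0..2 * pi})"
      by simp
  qed simp
  with False show ?thesis by simp
qed

text \<open>Decay faster than every power is stable under multiplication by powers of k, so series
  with such coefficients can be differentiated arbitrarily often.\<close>

definition rapid :: "(int \<Rightarrow> complex) \<Rightarrow> bool" where
  "rapid b \<longleftrightarrow> (\<forall>p::nat. \<exists>B. \<forall>k. cmod (b k) * \<bar>of_int k\<bar> ^ p \<le> B)"

text \<open>The sum over all integers is enumerated by \<open>int_decode\<close>, so that results on
  series indexed by naturals apply; for \<open>rapid\<close> coefficients convergence is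
  absolute.\<close>

definition trig :: "(int \<Rightarrow> complex) \<Rightarrow> real \<Rightarrow> complex" where
  "trig b t = (\<Sum>n. b (int_decode n) * fexp (int_decode n) t)"

text \<open>The enumeration runs 0, -1, 1, -2, ..., so quadratic decay in k becomes quadratic decay
  in the position n.\<close>

lemma int_decode_ge: "real (Suc n) \<le> 2 * (1 + \<bar>real_of_int (int_decode n)\<bar>)"
proof -
  have "int (Suc n) \<le> 2 * (1 + \<bar>int_decode n\<bar>)"
    by (auto simp: int_decode_def sum_decode_def elim!: evenE oddE)
  then have "real_of_int (int (Suc n)) \<le> real_of_int (2 * (1 + \<bar>int_decode n\<bar>))"
    by (simp only: of_int_le_iff)
  then show ?thesis by simp
qed

definition trig_const :: real where "trig_const = 8 * (\<Sum>n. 1 / real (Suc n) ^ 2)"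

lemma summable_inv_sq: "summable (\<lambda>n. 1 / real (Suc n) ^ 2)"
  using inverse_power_summable[of 2, where 'a = real]
    summable_Suc_iff[of "\<lambda>n. inverse (real n ^ 2)"] by (simp add: inverse_eq_divide)

lemma trig_const_nonneg: "trig_const \<ge> 0"
  unfolding trig_const_def by (intro mult_nonneg_nonneg suminf_nonneg summable_inv_sq) auto

lemma trig_term_bound:
  assumes "\<And>k. cmod (b k) \<le> B" "\<And>k. cmod (b k) * \<bar>of_int k\<bar> ^ 2 \<le> B"
  shows "cmod (b (int_decode n)) \<le> 16 * B * (1 / real (Suc n) ^ 2)"
proof -
  define x where "x = \<bar>real_of_int (int_decode n)\<bar>"
  let ?c = "cmod (b (int_decode n))"
  have "real (Suc n) ^ 2 \<le> (2 * (1 + x)) ^ 2"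
    unfolding x_def by (intro power_mono int_decode_ge) auto
  \<comment> \<open>This is (x - 1)^2 >= 0, and the origin of the 8 in
    \<open>trig_const\<close>.\<close>
  also have "\<dots> \<le> 8 * (1 + x ^ 2)"
    using sum_squares_ge_zero[of "x - 1" 0] by (simp add: power2_eq_square algebra_simps)
  finally have "?c * real (Suc n) ^ 2 \<le> ?c * (8 * (1 + x ^ 2))"
    by (intro mult_left_mono) auto
  also have "\<dots> = 8 * (?c + ?c * x ^ 2)" by (simp add: algebra_simps)
  also have "\<dots> \<le> 8 * (B + B)"
    using assms(1)[of "int_decode n"] assms(2)[of "int_decode n"] unfolding x_def
    by (intro mult_left_mono add_mono) auto
  finally show ?thesis by (simp add: field_simps)
qed

lemma rapidD:
  assumes "rapid b"
  obtains B where "\<And>k. cmod (b k) \<le> B" "\<And>k. cmod (b k) * \<bar>of_int k\<bar> ^ 2 \<le> B"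
proof -
  obtain B0 where B0: "\<And>k. cmod (b k) * \<bar>of_int k\<bar> ^ 0 \<le> B0" using assms unfolding rapid_def by blast
  obtain B2 where B2: "\<And>k. cmod (b k) * \<bar>of_int k\<bar> ^ 2 \<le> B2" using assms unfolding rapid_def by blast
  show ?thesis
    using B0 B2 by (intro that[of "max B0 B2"]) (auto simp: le_max_iff_disj)
qed

lemma rapid_mult_index:
  assumes "rapid b" shows "rapid (\<lambda>k. b k * of_int k ^ p)"
  unfolding rapid_def
proof
  fix q
  obtain B where "\<And>k. cmod (b k) * \<bar>of_int k\<bar> ^ (p + q) \<le> B" using assms unfolding rapid_def by blast
  then show "\<exists>B. \<forall>k. cmod (b k * of_int k ^ p) * \<bar>of_int k\<bar> ^ q \<le> B"
    by (intro exI[of _ B]) (auto simp: norm_mult norm_power power_add mult.assoc)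
qed

lemma summable_norm_coeffs:
  assumes "rapid b" shows "summable (\<lambda>n. cmod (b (int_decode n)))"
proof -
  obtain B where B: "\<And>k. cmod (b k) \<le> B" "\<And>k. cmod (b k) * \<bar>of_int k\<bar> ^ 2 \<le> B"
    using rapidD[OF assms] by blast
  show ?thesis
    by (rule summable_comparison_test'[OF summable_mult[OF summable_inv_sq, of "16 * B"], of 0])
       (use trig_term_bound[OF B] in auto)
qed

lemma trig_bound:
  assumes "\<And>k. cmod (b k) \<le> B" "\<And>k. cmod (b k) * \<bar>of_int k\<bar> ^ 2 \<le> B"
  shows "cmod (trig b t) \<le> 2 * B * trig_const"
proof -
  have "cmod (trig b t) \<le> (\<Sum>n. 16 * B * (1 / real (Suc n) ^ 2))"
    unfolding trig_def
    by (intro norm_suminf_le summable_mult summable_inv_sq)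
       (use trig_term_bound[OF assms] in \<open>auto simp: norm_mult\<close>)
  also have "\<dots> = 2 * B * trig_const"
    by (subst suminf_mult[OF summable_inv_sq]) (simp add: trig_const_def)
  finally show ?thesis .
qed

lemma trig_uniform_limit:
  assumes "rapid b"
  shows "uniform_limit UNIV (\<lambda>n t. \<Sum>i<n. b (int_decode i) * fexp (int_decode i) t) (trig b) sequentially"
  unfolding trig_def
  by (rule Weierstrass_m_test[OF _ summable_norm_coeffs[OF assms]]) (auto simp: norm_mult)

lemma summable_trig: "rapid b \<Longrightarrow> summable (\<lambda>n. b (int_decode n) * fexp (int_decode n) t)"
  by (rule summable_comparison_test'[OF summable_norm_coeffs, of b 0]) (auto simp: norm_mult)

text \<open>Termwise differentiation is legitimate because the coefficients
  \<open>b k * of_int k\<close> are again rapid, so the differentiated series converges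
  uniformly.\<close>

lemma trig_has_vector_derivative:
  assumes "rapid b"
  shows "(trig b has_vector_derivative \<i> * trig (\<lambda>k. b k * of_int k) t) (at t)"
proof -
  let ?k = int_decode
  let ?d = "\<lambda>t. \<i> * trig (\<lambda>k. b k * of_int k) t"
  have r: "rapid (\<lambda>k. b k * of_int k)" using rapid_mult_index[OF assms, of 1] by simp
  have "\<exists>g. \<forall>x\<in>UNIV. (\<lambda>n. b (?k n) * fexp (?k n) x) sums (g x) \<and>
     (g has_derivative (\<lambda>h. h *\<^sub>R ?d x)) (at x within UNIV)"
  proof (rule has_derivative_series[where f' = "\<lambda>n x h. h *\<^sub>R (b (?k n) * (\<i> * of_int (?k n) * fexp (?k n) x))"])
    fix n x
    show "((\<lambda>x. b (?k n) * fexp (?k n) x) has_derivative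
        (\<lambda>h. h *\<^sub>R (b (?k n) * (\<i> * of_int (?k n) * fexp (?k n) x)))) (at x within UNIV)"
      using has_vector_derivative_mult_right[OF fexp_has_vector_derivative, of "b (?k n)"]
      by (simp add: has_vector_derivative_def)
  next
    fix e :: real assume e: "e > 0"
    have "\<forall>\<^sub>F n in sequentially. \<forall>x\<in>UNIV. cmod ((\<Sum>i<n. (b (?k i) * of_int (?k i)) * fexp (?k i) x)
        - trig (\<lambda>k. b k * of_int k) x) < e"
      using trig_uniform_limit[OF r] e unfolding uniform_limit_iff dist_norm by blast
    then show "\<forall>\<^sub>F n in sequentially. \<forall>x\<in>UNIV. \<forall>h. norm
       ((\<Sum>i<n. h *\<^sub>R (b (?k i) * (\<i> * of_int (?k i) * fexp (?k i) x))) - h *\<^sub>R ?d x) \<le> e * norm h"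
    proof eventually_elim
      case (elim n)
      show ?case
      proof (intro ballI allI)
        fix x h :: real
        \<comment> \<open>The error is linear in \<open>h\<close>, so uniform convergence of the
          differentiated series yields the required multiple of \<open>norm h\<close>.\<close>
        have "(\<Sum>i<n. h *\<^sub>R (b (?k i) * (\<i> * of_int (?k i) * fexp (?k i) x))) - h *\<^sub>R ?d x
            = h *\<^sub>R (\<i> * ((\<Sum>i<n. (b (?k i) * of_int (?k i)) * fexp (?k i) x) - trig (\<lambda>k. b k * of_int k) x))"
          by (simp add: algebra_simps sum_distrib_left scaleR_sum_right)
        then show "norm ((\<Sum>i<n. h *\<^sub>R (b (?k i) * (\<i> * of_int (?k i) * fexp (?k i) x))) - h *\<^sub>R ?d x) \<le> e * norm h"
          using mult_left_mono[OF less_imp_le[OF elim[rule_format, OF UNIV_I, of x]], of "\<bar>h\<bar>"]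
          by (simp only: norm_scaleR norm_mult norm_ii real_norm_def mult_1 abs_ge_zero mult.commute[of e] simp_thms)
      qed
    qed
  next
    show "(\<lambda>n. b (?k n) * fexp (?k n) 0) sums trig b 0"
      using summable_trig[OF assms] unfolding trig_def by (rule summable_sums)
  qed auto
  then obtain g where g: "\<And>x. (\<lambda>n. b (?k n) * fexp (?k n) x) sums g x"
    "\<And>x. (g has_vector_derivative ?d x) (at x)"
    by (auto simp: has_vector_derivative_def)
  have "g = trig b" using g(1) by (auto simp: trig_def sums_iff)
  with g(2) show ?thesis by simp
qed

lemma Dop_trig: "rapid b \<Longrightarrow> Dop (trig b) = trig (\<lambda>k. b k * of_int k)"
  by (rule ext) (simp add: Dop_def vector_derivative_at[OF trig_has_vector_derivative])

lemma Dop_pow_trig: "rapid b \<Longrightarrow> (Dop ^^ p) (trig b) = trig (\<lambda>k. b k * of_int k ^ p)"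
  by (induction p) (simp_all add: Dop_trig rapid_mult_index mult_ac)

lemma smooth_periodic_trig:
  assumes "rapid b" shows "smooth_periodic (trig b)"
  unfolding smooth_periodic_def Dop_pow_trig[OF assms]
  using trig_has_vector_derivative[OF rapid_mult_index[OF assms]]
  by (auto simp: trig_def fexp_periodic differentiable_on_def
      intro!: differentiableI_vector[OF has_vector_derivative_at_within])

lemma trig_eq_sum:
  assumes "finite S" "\<And>k. k \<notin> S \<Longrightarrow> b k = 0"
  shows "trig b t = (\<Sum>k\<in>S. b k * fexp k t)"
proof -
  have "trig b t = (\<Sum>n\<in>int_encode ` S. b (int_decode n) * fexp (int_decode n) t)"
    unfolding trig_def using assms
    by (intro suminf_finite) (auto simp: image_iff, metis int_decode_inverse)
  also have "\<dots> = (\<Sum>k\<in>S. b k * fexp k t)"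
    by (subst sum.reindex) (auto simp: inj_int_encode)
  finally show ?thesis .
qed

lemma rapid_finite_support:
  assumes "finite S" "\<And>k. k \<notin> S \<Longrightarrow> b k = 0" shows "rapid b"
  unfolding rapid_def
proof
  fix p
  show "\<exists>B. \<forall>k. cmod (b k) * \<bar>of_int k\<bar> ^ p \<le> B"
  proof (intro exI allI)
    fix k
    show "cmod (b k) * \<bar>of_int k\<bar> ^ p \<le> (\<Sum>k\<in>S. cmod (b k) * \<bar>of_int k\<bar> ^ p)"
      using assms by (cases "k \<in> S") (auto intro!: member_le_sum sum_nonneg)
  qed
qed

text \<open>Uniform convergence exchanges sum and integral; by orthogonality the partial integrals
  are constant once the position \<open>int_encode k\<close> has been passed.\<close>

lemma integral_trig_fexp:
  fixes b :: "int \<Rightarrow> complex"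
  assumes "rapid b"
  shows "integral {0..2 * pi} (\<lambda>t. trig b t * fexp (- k) t) = of_real (2 * pi) * b k"
proof -
  let ?d = int_decode
  let ?f = "\<lambda>n t. \<Sum>i<(n::nat). b (?d i) * fexp (?d i) t"
  have "uniform_limit {0..2 * pi} (\<lambda>n t. fexp (- k) t * ?f n t) (\<lambda>t. fexp (- k) t * trig b t) sequentially"
  proof (rule uniform_limitI)
    fix e :: real assume "e > 0"
    then have "\<forall>\<^sub>F n in sequentially. \<forall>t\<in>UNIV. dist (?f n t) (trig b t) < e"
      using trig_uniform_limit[OF assms] unfolding uniform_limit_iff by blast
    then show "\<forall>\<^sub>F n in sequentially. \<forall>t\<in>{0..2*pi}. dist (fexp (- k) t * ?f n t) (fexp (- k) t * trig b t) < e"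
      by eventually_elim (simp add: dist_norm norm_mult flip: right_diff_distrib)
  qed
  moreover have "continuous_on {0..2 * pi} (\<lambda>t. fexp (- k) t * ?f n t)" for n
    by (intro continuous_intros)
  ultimately obtain I J where I: "\<And>n. ((\<lambda>t. fexp (- k) t * ?f n t) has_integral I n) {0..2 * pi}"
    and J: "((\<lambda>t. fexp (- k) t * trig b t) has_integral J) {0..2 * pi}" and IJ: "I \<longlonglongrightarrow> J"
    by (rule uniform_limit_integral) auto
  have "((\<lambda>t. fexp (- k) t * ?f n t) has_integral (\<Sum>i<n. b (?d i) * (if ?d i - k = 0 then of_real (2 * pi) else 0))) {0..2 * pi}" for n
  proof -
    have "(\<lambda>t. fexp (- k) t * ?f n t) = (\<lambda>t. \<Sum>i<n. b (?d i) * fexp (?d i - k) t)"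
      using fexp_add[of _ "- k"] by (auto simp: sum_distrib_left mult_ac fun_eq_iff)
    then show ?thesis
      by (simp only:) (intro has_integral_sum has_integral_mult_right has_integral_fexp finite_lessThan)
  qed
  then have In: "I n = (\<Sum>i<n. b (?d i) * (if ?d i - k = 0 then of_real (2 * pi) else 0))" for n
    using I has_integral_unique by blast
  have "I n = of_real (2 * pi) * b k" if "n > int_encode k" for n
  proof -
    have "I n = (\<Sum>i<n. if i = int_encode k then of_real (2 * pi) * b k else 0)"
      unfolding In by (intro sum.cong) (auto simp: mult.commute)
    then show ?thesis using that by simp
  qed
  then have "I \<longlonglongrightarrow> of_real (2 * pi) * b k"
    by (intro tendsto_eventually eventually_sequentiallyI[of "Suc (int_encode k)"]) auto
  with IJ have "J = of_real (2 * pi) * b k" using LIMSEQ_unique by blast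
  with J show ?thesis by (auto simp: mult.commute integral_unique)
qed

section \<open>Fourier coefficients and uniqueness\<close>

lemma fourier_coeff_fexp:
  "fourier_coeff g k = integral {0..2 * pi} (\<lambda>t. g t * fexp (- k) t) / of_real (2 * pi)"
  by (simp add: fourier_coeff_def fexp_def)

lemma fourier_coeff_trig: "rapid b \<Longrightarrow> fourier_coeff (trig b) k = b k"
  by (simp add: fourier_coeff_fexp integral_trig_fexp)

lemma norm_fourier_coeff_le:
  assumes "continuous_on UNIV g" "\<And>t. cmod (g t) \<le> B"
  shows "cmod (fourier_coeff g k) \<le> B"
proof -
  have "cmod (integral {0..2 * pi} (\<lambda>t. g t * fexp (- k) t)) \<le> B * (2 * pi - 0)"
    by (rule integral_bound)
       (use assms in \<open>auto simp: norm_mult intro!: continuous_intros continuous_on_subset[OF assms(1)]\<close>)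
  then show ?thesis by (simp add: fourier_coeff_fexp norm_divide field_simps)
qed

lemma Dop_has_vector_derivative:
  assumes "g differentiable_on UNIV"
  shows "(g has_vector_derivative \<i> * Dop g t) (at t)"
  using assms vector_derivative_works[of g "at t"]
  by (simp add: Dop_def differentiable_on_def)

lemma Dop_periodic:
  assumes "g differentiable_on UNIV" "\<And>t. g (t + 2 * pi) = g t"
  shows "Dop g (t + 2 * pi) = Dop g t"
proof -
  have "((\<lambda>t. g (t + 2 * pi)) has_vector_derivative 1 *\<^sub>R (\<i> * Dop g (t + 2 * pi))) (at t)"
    using vector_diff_chain_at[of "\<lambda>t. t + 2 * pi" 1 t g "\<i> * Dop g (t + 2 * pi)"]
      Dop_has_vector_derivative[OF assms(1), of "t + 2 * pi"]
      has_vector_derivative_add_const[of "\<lambda>t. t" "2 * pi" 1 "at t"]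
    by (simp add: o_def)
  then have "(g has_vector_derivative \<i> * Dop g (t + 2 * pi)) (at t)"
    by (simp add: assms(2))
  from vector_derivative_unique_at[OF this Dop_has_vector_derivative[OF assms(1)]]
  show ?thesis by simp
qed

lemma smooth_Dop_pow:
  assumes "smooth_periodic g"
  shows "(Dop ^^ p) g differentiable_on UNIV" "continuous_on UNIV ((Dop ^^ p) g)"
    "(Dop ^^ p) g (t + 2 * pi) = (Dop ^^ p) g t"
proof -
  show d: "(Dop ^^ p) g differentiable_on UNIV" for p using assms by (simp add: smooth_periodic_def)
  then show "continuous_on UNIV ((Dop ^^ p) g)" by (rule differentiable_imp_continuous_on)
  show "(Dop ^^ p) g (t + 2 * pi) = (Dop ^^ p) g t"
    using assms by (induction p arbitrary: t) (auto simp: smooth_periodic_def intro!: Dop_periodic d)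
qed

text \<open>Integration by parts: \<open>g t * fexp (- k) t\<close> has equal values at both ends of
  the period, so its derivative integrates to 0.\<close>

lemma fourier_coeff_Dop:
  assumes "g differentiable_on UNIV" "continuous_on UNIV (Dop g)" "\<And>t. g (t + 2 * pi) = g t"
  shows "fourier_coeff (Dop g) k = of_int k * fourier_coeff g k"
proof -
  have c: "continuous_on UNIV g" using assms(1) by (rule differentiable_imp_continuous_on)
  have i: "(\<lambda>t. g t * fexp (- k) t) integrable_on {0..2 * pi}" 
    "(\<lambda>t. Dop g t * fexp (- k) t) integrable_on {0..2 * pi}"
    by (intro integrable_continuous_real continuous_intros continuous_on_subset[OF c] continuous_on_subset[OF assms(2)]; simp)+
  have "((\<lambda>t. g t * (\<i> * of_int (- k) * fexp (- k) t) + (\<i> * Dop g t) * fexp (- k) t)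
      has_integral g (2 * pi) * fexp (- k) (2 * pi) - g 0 * fexp (- k) 0) {0..2 * pi}"
    by (rule fundamental_theorem_of_calculus)
       (auto intro!: has_vector_derivative_mult fexp_has_vector_derivative
          has_vector_derivative_at_within[OF Dop_has_vector_derivative[OF assms(1)]] simp del: of_int_minus)
  then have 0: "((\<lambda>t. g t * (\<i> * of_int (- k) * fexp (- k) t) + (\<i> * Dop g t) * fexp (- k) t)
      has_integral 0) {0..2 * pi}"
    using assms(3)[of 0] by simp
  have "((\<lambda>t. \<i> * (Dop g t * fexp (- k) t) - \<i> * of_int k * (g t * fexp (- k) t)) has_integral
     \<i> * integral {0..2 * pi} (\<lambda>t. Dop g t * fexp (- k) t) - \<i> * of_int k * integral {0..2 * pi} (\<lambda>t. g t * fexp (- k) t)) {0..2 * pi}"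
    by (intro has_integral_diff has_integral_mult_right integrable_integral i)
  also have "(\<lambda>t. \<i> * (Dop g t * fexp (- k) t) - \<i> * of_int k * (g t * fexp (- k) t)) =
      (\<lambda>t. g t * (\<i> * of_int (- k) * fexp (- k) t) + (\<i> * Dop g t) * fexp (- k) t)"
    by (auto simp: algebra_simps)
  finally have "\<i> * integral {0..2 * pi} (\<lambda>t. Dop g t * fexp (- k) t) - \<i> * of_int k * integral {0..2 * pi} (\<lambda>t. g t * fexp (- k) t) = 0"
    using 0 has_integral_unique by blast
  then have "\<i> * (integral {0..2 * pi} (\<lambda>t. Dop g t * fexp (- k) t) - of_int k * integral {0..2 * pi} (\<lambda>t. g t * fexp (- k) t)) = 0"
    by (simp add: algebra_simps)
  then show ?thesis by (simp add: fourier_coeff_fexp)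
qed

lemma fourier_coeff_Dop_pow:
  assumes "smooth_periodic g"
  shows "fourier_coeff ((Dop ^^ p) g) k = of_int k ^ p * fourier_coeff g k"
proof (induction p)
  case (Suc p)
  then show ?case
    using fourier_coeff_Dop[of "(Dop ^^ p) g" k] smooth_Dop_pow[OF assms, of p] smooth_Dop_pow(2)[OF assms, of "Suc p"]
    by simp
qed simp

lemma norm_fourier_coeff_pow_le:
  assumes "smooth_periodic g" "\<And>t. cmod ((Dop ^^ p) g t) \<le> B"
  shows "cmod (fourier_coeff g k) * \<bar>of_int k\<bar> ^ p \<le> B"
  using norm_fourier_coeff_le[OF smooth_Dop_pow(2)[OF assms(1)] assms(2), of k]
  by (simp add: fourier_coeff_Dop_pow[OF assms(1)] norm_mult norm_power mult.commute)

section \<open>Uniform approximation of periodic functions by trigonometric polynomials, and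
  uniqueness\<close>

lemma periodic_int:
  fixes g :: "real \<Rightarrow> 'a"
  assumes "\<And>t. g (t + 2 * pi) = g t"
  shows "g (t + 2 * pi * of_int n) = g t"
proof (induction n rule: int_induct[where k = 0])
  case (step1 i)
  with assms[of "t + 2 * pi * of_int i"] show ?case by (simp add: algebra_simps)
next
  case (step2 i)
  with assms[of "t + 2 * pi * of_int (i - 1)"] show ?case by (simp add: algebra_simps)
qed simp

lemma periodic_cis:
  fixes g :: "real \<Rightarrow> 'a"
  assumes "\<And>t. g (t + 2 * pi) = g t" "cis a = cis b"
  shows "g a = g b"
proof -
  have "sin a = sin b \<and> cos a = cos b" using assms(2) by (simp add: complex_eq_iff)
  then obtain n :: int where "a = b + 2 * pi * n" by (auto simp: sin_cos_eq_iff)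
  with periodic_int[of g b n] assms(1) show ?thesis by simp
qed

text \<open>\<open>Arg\<close> jumps across the negative real axis; near that axis
  \<open>Arg (- w) + pi\<close> is a continuous choice of argument, and periodicity of
  \<open>g\<close> hides the difference.\<close>

lemma continuous_on_circle:
  fixes g :: "real \<Rightarrow> 'a :: t2_space"
  assumes "continuous_on UNIV g" "\<And>t. g (t + 2 * pi) = g t"
  shows "continuous_on (sphere 0 1) (\<lambda>z. g (Arg z))"
proof (intro continuous_at_imp_continuous_on ballI)
  fix z :: complex assume "z \<in> sphere 0 1"
  then have z: "z \<noteq> 0" by auto
  have g: "isCont g t" for t using assms(1) by (simp add: continuous_on_eq_continuous_at)
  show "isCont (\<lambda>z. g (Arg z)) z"
  proof (cases "z \<in> \<real>\<^sub>\<le>\<^sub>0")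
    case False
    then show ?thesis using isCont_o2[of z Arg g] continuous_at_Arg g by simp
  next
    case True
    then have "- z \<notin> \<real>\<^sub>\<le>\<^sub>0" using z by (auto simp: complex_nonpos_Reals_iff complex_eq_iff)
    then have "isCont (\<lambda>w. Arg (- w)) z"
      using isCont_o2[of z uminus Arg] continuous_at_Arg by simp
    then have c: "isCont (\<lambda>w. g (Arg (- w) + pi)) z"
      using isCont_o2[of z "\<lambda>w. Arg (- w) + pi" g] g by simp
    have "g (Arg w) = g (Arg (- w) + pi)" if "w \<noteq> 0" for w
    proof (rule periodic_cis[of g, OF assms(2)])
      show "cis (Arg w) = cis (Arg (- w) + pi)"
        using that cis_Arg[of w] cis_Arg[of "- w"] by (simp add: cis_mult[symmetric] sgn_minus)
    qed
    moreover have "\<forall>\<^sub>F w in nhds z. w \<noteq> 0"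
      using z by (intro t1_space_nhds)
    ultimately have "\<forall>\<^sub>F w in nhds z. g (Arg w) = g (Arg (- w) + pi)"
      by (auto elim: eventually_mono)
    with c show ?thesis by (subst isCont_cong)
  qed
qed

inductive trig_poly :: "(real \<Rightarrow> complex) \<Rightarrow> bool" where
  monom: "trig_poly (\<lambda>t. a * fexp k t)"
| add: "trig_poly u \<Longrightarrow> trig_poly v \<Longrightarrow> trig_poly (\<lambda>t. u t + v t)"

lemma trig_poly_mult:
  assumes "trig_poly u" "trig_poly v" shows "trig_poly (\<lambda>t. u t * v t)"
  using assms(1)
proof induction
  case (monom a k)
  from assms(2) show ?case
  proof induction
    case (monom b l)
    have "(\<lambda>t. a * fexp k t * (b * fexp l t)) = (\<lambda>t. (a * b) * fexp (k + l) t)"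
      by (auto simp: fexp_add)
    then show ?case by (simp only: trig_poly.monom)
  next
    case (add u v)
    then show ?case using trig_poly.add by (simp add: algebra_simps)
  qed
next
  case (add u w)
  then show ?case using trig_poly.add by (simp add: algebra_simps)
qed

lemma trig_poly_cmult: "trig_poly u \<Longrightarrow> trig_poly (\<lambda>t. c * u t)"
  using trig_poly_mult[OF trig_poly.monom[of c 0], of u] by simp

lemma continuous_on_trig_poly: "trig_poly u \<Longrightarrow> continuous_on S u"
  by (induction rule: trig_poly.induct) (auto intro!: continuous_intros)

text \<open>Real Stone-Weierstrass, applied to the functions on the circle whose pullback along
  \<open>cis\<close> is a trigonometric polynomial: they form an algebra, and \<open>Re\<close> and
  \<open>Im\<close> separate points.\<close>

lemma trig_poly_dense_circle:
  fixes G :: "complex \<Rightarrow> real"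
  assumes "continuous_on (sphere 0 1) G" "e > 0"
  obtains u where "trig_poly u" "\<And>t. cmod (of_real (G (cis t)) - u t) < e"
proof -
  let ?P = "\<lambda>f :: complex \<Rightarrow> real. continuous_on (sphere 0 1) f \<and> trig_poly (\<lambda>t. of_real (f (cis t)))"
  have fexp: "fexp 1 t = cis t" "fexp (- 1) t = cis (- t)" for t
    by (simp_all add: fexp_def cis_conv_exp)
  have "\<exists>f. ?P f \<and> (\<forall>x\<in>sphere 0 1. \<bar>G x - f x\<bar> < e)"
  proof (rule Stone_Weierstrass_HOL[where P = ?P, OF compact_sphere])
    show "?P (\<lambda>x. c)" for c
      using trig_poly.monom[of "of_real c" 0] by (auto intro!: continuous_intros)
    show "?P (\<lambda>x. f x + g x)" if "?P f \<and> ?P g" for f g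
      using that by (auto intro!: continuous_intros trig_poly.add)
    show "?P (\<lambda>x. f x * g x)" if "?P f \<and> ?P g" for f g
      using that by (auto intro!: continuous_intros trig_poly_mult)
    have "(\<lambda>t. of_real (Re (cis t))) = (\<lambda>t. 1 / 2 * fexp 1 t + 1 / 2 * fexp (- 1) t)"
      "(\<lambda>t. of_real (Im (cis t))) = (\<lambda>t. - \<i> / 2 * fexp 1 t + \<i> / 2 * fexp (- 1) t)"
      unfolding fexp by (auto simp: complex_eq_iff)
    then have "?P Re" "?P Im"
      by (simp_all only: continuous_on_id trig_poly.intros continuous_on_Re continuous_on_Im simp_thms)
    then show "\<exists>f. ?P f \<and> f x \<noteq> f y" if "x \<in> sphere 0 1 \<and> y \<in> sphere 0 1 \<and> x \<noteq> y" for x y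
      using that by (auto simp: complex_eq_iff)
  qed (use assms in auto)
  then obtain f where f: "?P f" "\<forall>x\<in>sphere 0 1. \<bar>G x - f x\<bar> < e" by blast
  show ?thesis
    using f by (intro that[of "\<lambda>t. of_real (f (cis t))"]) (auto simp flip: of_real_diff)
qed

lemma trig_poly_dense:
  fixes g :: "real \<Rightarrow> complex"
  assumes g: "continuous_on UNIV g" and per: "\<And>t. g (t + 2 * pi) = g t" and "e > 0"
  obtains u where "trig_poly u" "\<And>t. cmod (g t - u t) < e"
proof -
  have G: "continuous_on (sphere 0 1) (\<lambda>z. Re (g (Arg z)))" "continuous_on (sphere 0 1) (\<lambda>z. Im (g (Arg z)))"
    by (intro continuous_intros continuous_on_circle[OF g per])+
  have eq: "g (Arg (cis t)) = g t" for t
    using cis_Arg[of "cis t"] by (intro periodic_cis[of g, OF per]) (simp add: sgn_div_norm)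
  obtain u v where u: "trig_poly u" "\<And>t. cmod (of_real (Re (g t)) - u t) < e / 2"
    and v: "trig_poly v" "\<And>t. cmod (of_real (Im (g t)) - v t) < e / 2"
    using trig_poly_dense_circle[OF G(1), of "e / 2"] trig_poly_dense_circle[OF G(2), of "e / 2"] \<open>e > 0\<close>
    unfolding eq by (metis half_gt_zero)
  show ?thesis
  proof (rule that)
    show "trig_poly (\<lambda>t. u t + \<i> * v t)" by (intro trig_poly.add trig_poly_cmult u v)
    fix t
    have "g t - (u t + \<i> * v t) = (of_real (Re (g t)) - u t) + \<i> * (of_real (Im (g t)) - v t)"
      by (subst complex_eq[of "g t"]) (simp add: algebra_simps)
    then have "cmod (g t - (u t + \<i> * v t)) \<le> cmod (of_real (Re (g t)) - u t) + cmod (\<i> * (of_real (Im (g t)) - v t))"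
      using norm_triangle_ineq by metis
    then show "cmod (g t - (u t + \<i> * v t)) < e" using u(2)[of t] v(2)[of t] by (simp add: norm_mult)
  qed
qed

text \<open>Approximation within 1 by a trigonometric polynomial reduces the claim to finite sums of
  exponentials.\<close>

lemma periodic_bounded:
  fixes g :: "real \<Rightarrow> complex"
  assumes "continuous_on UNIV g" "\<And>t. g (t + 2 * pi) = g t"
  obtains B where "B > 0" "\<And>t. cmod (g t) \<le> B"
proof -
  obtain u where u: "trig_poly u" "\<And>t. cmod (g t - u t) < 1"
    using trig_poly_dense[OF assms, of 1] by auto
  have "\<exists>B>0. \<forall>t. cmod (u t) \<le> B" using u(1)
  proof induction
    case (monom a k)
    then show ?case by (intro exI[of _ "cmod a + 1"]) (auto simp: norm_mult add_nonneg_pos)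
  next
    case (add u v)
    then obtain A B where "A > 0" "\<forall>t. cmod (u t) \<le> A" "B > 0" "\<forall>t. cmod (v t) \<le> B" by blast
    then show ?case by (intro exI[of _ "A + B"]) (auto intro!: norm_triangle_mono)
  qed
  then obtain B where B: "B > 0" "\<And>t. cmod (u t) \<le> B" by blast
  have "cmod (g t) \<le> B + 1" for t
    using norm_triangle_ineq[of "u t" "g t - u t"] u(2)[of t] B(2)[of t] by simp
  with B(1) show ?thesis by (intro that[of "B + 1"]) auto
qed

text \<open>\<open>g\<close> is orthogonal to all trigonometric polynomials; approximating
  \<open>cnj (g t)\<close> uniformly by them forces the integral of |g|^2 to vanish, and continuity
  does the rest.\<close>

lemma fourier_coeff_eq_0_imp:
  fixes g :: "real \<Rightarrow> complex"
  assumes g: "continuous_on UNIV g" and per: "\<And>t. g (t + 2 * pi) = g t"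
    and 0: "\<And>k. fourier_coeff g k = 0"
  shows "g t = 0"
proof -
  obtain B where B: "B > 0" "\<And>t. cmod (g t) \<le> B" using periodic_bounded[OF g per] by blast
  have gc: "continuous_on S g" for S using g continuous_on_subset by blast
  have orth: "((\<lambda>t. g t * u t) has_integral 0) {0..2 * pi}" if "trig_poly u" for u
    using that
  proof induction
    case (monom a k)
    have "(\<lambda>t. g t * fexp k t) integrable_on {0..2 * pi}"
      by (intro integrable_continuous_real continuous_intros gc)
    moreover have "integral {0..2 * pi} (\<lambda>t. g t * fexp k t) = 0"
      using 0[of "- k"] by (simp add: fourier_coeff_fexp)
    ultimately have "((\<lambda>t. g t * fexp k t) has_integral 0) {0..2 * pi}"
      by (metis integrable_integral)
    from has_integral_mult_right[OF this, of a] show ?case by (simp add: mult.left_commute)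
  next
    case (add u v)
    from has_integral_add[OF add.IH] show ?case by (simp add: distrib_left)
  qed
  have i: "(\<lambda>t. g t * cnj (g t)) integrable_on {0..2 * pi}"
    by (intro integrable_continuous_real continuous_intros gc)
  have "cmod (integral {0..2 * pi} (\<lambda>t. g t * cnj (g t))) \<le> e" if "e > 0" for e
  proof -
    \<comment> \<open>Chosen so that the final bound \<open>B * d * (2 * pi)\<close> equals
      \<open>e\<close>.\<close>
    define d where "d = e / (2 * pi * B)"
    have "d > 0" using that B by (simp add: d_def)
    obtain u where u: "trig_poly u" "\<And>t. cmod (cnj (g t) - u t) < d"
      using trig_poly_dense[of "\<lambda>t. cnj (g t)" d] \<open>d > 0\<close> gc per by (auto intro: continuous_intros)
    have "((\<lambda>t. g t * cnj (g t) - g t * u t) has_integral (integral {0..2 * pi} (\<lambda>t. g t * cnj (g t)) - 0)) {0..2 * pi}"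
      by (intro has_integral_diff integrable_integral i orth u)
    then have "integral {0..2 * pi} (\<lambda>t. g t * cnj (g t)) = integral {0..2 * pi} (\<lambda>t. g t * cnj (g t) - g t * u t)"
      by (simp add: integral_unique)
    also have "cmod \<dots> \<le> B * d * (2 * pi - 0)"
    proof (rule integral_bound)
      show "continuous_on {0..2 * pi} (\<lambda>t. g t * cnj (g t) - g t * u t)"
        by (intro continuous_intros gc continuous_on_trig_poly u)
      fix t
      have "cmod (g t * (cnj (g t) - u t)) \<le> B * d"
        unfolding norm_mult using B(2)[of t] u(2)[of t] B(1) by (intro mult_mono) auto
      then show "cmod (g t * cnj (g t) - g t * u t) \<le> B * d" by (simp add: algebra_simps)
    qed simp
    also have "\<dots> = e" using B(1) by (simp add: d_def)
    finally show ?thesis .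
  qed
  then have "integral {0..2 * pi} (\<lambda>t. g t * cnj (g t)) = 0"
    using field_le_epsilon[of "cmod (integral {0..2 * pi} (\<lambda>t. g t * cnj (g t)))" 0] by simp
  then have "((\<lambda>t. Re (g t * cnj (g t))) has_integral 0) {0..2 * pi}"
    using has_integral_Re[OF integrable_integral[OF i]] by simp
  then have h: "((\<lambda>t. (cmod (g t))\<^sup>2) has_integral 0) {0..2 * pi}"
    by (simp add: complex_mult_cnj cmod_power2)
  have z: "g t = 0" if "t \<in> {0..2 * pi}" for t
  proof -
    have "continuous_on (cbox 0 (2 * pi)) (\<lambda>t. (cmod (g t))\<^sup>2)" by (intro continuous_intros gc)
    from has_integral_0_cbox_imp_0[OF this, of t] h that have "(cmod (g t))\<^sup>2 = 0"
      using pi_ge_zero pi_gt_zero by (auto simp del: power_eq_0_iff zero_eq_power2)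
    then show ?thesis by simp
  qed
  \<comment> \<open>Shifting by \<open>n\<close> periods brings an arbitrary \<open>t\<close> into
    the base interval.\<close>
  define n where "n = \<lfloor>t / (2 * pi)\<rfloor>"
  have "of_int n \<le> t / (2 * pi)" "t / (2 * pi) \<le> of_int n + 1"
    unfolding n_def by linarith+
  then have "t + 2 * pi * of_int (- n) \<in> {0..2 * pi}"
    by (auto simp: field_simps)
  from z[OF this] show ?thesis using periodic_int[of g t "- n"] per by simp
qed

lemma trig_fourier_coeff:
  assumes "smooth_periodic g" "rapid (fourier_coeff g)"
  shows "g = trig (fourier_coeff g)"
proof
  fix t
  have s: "smooth_periodic (trig (fourier_coeff g))" using assms(2) by (rule smooth_periodic_trig)
  have c: "continuous_on UNIV g" "continuous_on UNIV (trig (fourier_coeff g))"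
    using smooth_Dop_pow(2)[OF assms(1), of 0] smooth_Dop_pow(2)[OF s, of 0] by auto
  have "g t - trig (fourier_coeff g) t = 0"
  proof (rule fourier_coeff_eq_0_imp[where g = "\<lambda>t. g t - trig (fourier_coeff g) t"])
    show "fourier_coeff (\<lambda>t. g t - trig (fourier_coeff g) t) k = 0" for k
    proof -
      have "integral {0..2 * pi} (\<lambda>t. g t * fexp (- k) t - trig (fourier_coeff g) t * fexp (- k) t) =
         integral {0..2 * pi} (\<lambda>t. g t * fexp (- k) t) - integral {0..2 * pi} (\<lambda>t. trig (fourier_coeff g) t * fexp (- k) t)"
        by (intro integral_diff integrable_continuous_real continuous_intros
            continuous_on_subset[OF c(1)] continuous_on_subset[OF c(2)]; simp)
      then show ?thesis
        using fourier_coeff_trig[OF assms(2), of k]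
        by (simp add: fourier_coeff_fexp left_diff_distrib diff_divide_distrib)
    qed
  qed (use assms(1) s c in \<open>auto simp: smooth_periodic_def intro!: continuous_intros\<close>)
  then show "g t = trig (fourier_coeff g) t" by simp
qed

section \<open>Ultradifferentiable seminorms\<close>

text \<open>For continuous \<open>g\<close> the set where \<open>cmod (g t) \<le> c\<close> is
  closed; if it has full measure it is everything, so an essential bound is a pointwise one.\<close>

lemma Linf_norm_le_iff:
  assumes "continuous_on UNIV g" "c \<ge> 0"
  shows "Linf_norm g \<le> ennreal c \<longleftrightarrow> (\<forall>t. cmod (g t) \<le> c)"
proof
  have m: "(\<lambda>t. ennreal (cmod (g t))) \<in> borel_measurable lborel"
    using borel_measurable_continuous_onI[OF assms(1)] by measurable
  { assume "Linf_norm g \<le> ennreal c"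
    then have "AE t in lborel. ennreal (cmod (g t)) \<le> ennreal c"
      using esssup_AE[of "\<lambda>t. ennreal (cmod (g t))" lborel] unfolding Linf_norm_def
      by (auto elim: eventually_mono)
    then have "AE t in lborel. t \<in> {t. cmod (g t) \<le> c}"
      using assms(2) by simp
    then have "AE t in lebesgue. t \<in> {t. cmod (g t) \<le> c}"
      by (rule AE_completion)
    moreover have "closed {t. cmod (g t) \<le> c}"
      by (intro closed_Collect_le continuous_intros assms(1))
    ultimately show "\<forall>t. cmod (g t) \<le> c"
      using mem_closed_if_AE_lebesgue by blast }
  assume "\<forall>t. cmod (g t) \<le> c"
  then show "Linf_norm g \<le> ennreal c"
    unfolding Linf_norm_def by (intro esssup_I m) (auto intro!: ennreal_leI)
qed

lemma Dop_linear:
  assumes "f differentiable_on UNIV" "g differentiable_on UNIV"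
  shows "Dop (\<lambda>t. a * f t + b * g t) = (\<lambda>t. a * Dop f t + b * Dop g t)"
    "(\<lambda>t. a * f t + b * g t) differentiable_on UNIV"
proof -
  have "((\<lambda>t. a * f t + b * g t) has_vector_derivative a * (\<i> * Dop f t) + b * (\<i> * Dop g t)) (at t)" for t
    by (intro has_vector_derivative_add has_vector_derivative_mult_right Dop_has_vector_derivative assms)
  note d = this
  have "Dop (\<lambda>t. a * f t + b * g t) t = a * Dop f t + b * Dop g t" for t
    unfolding Dop_def[of "\<lambda>t. a * f t + b * g t"] vector_derivative_at[OF d]
    by (simp add: algebra_simps)
  then show "Dop (\<lambda>t. a * f t + b * g t) = (\<lambda>t. a * Dop f t + b * Dop g t)" by blast
  show "(\<lambda>t. a * f t + b * g t) differentiable_on UNIV"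
    using d by (auto simp: differentiable_on_def intro: differentiableI_vector)
qed

lemma Dop_pow_linear:
  assumes "smooth_periodic f" "smooth_periodic g"
  shows "(Dop ^^ p) (\<lambda>t. a * f t + b * g t) = (\<lambda>t. a * (Dop ^^ p) f t + b * (Dop ^^ p) g t)"
  by (induction p) (simp_all add: Dop_linear(1) smooth_Dop_pow(1) assms)

lemma smooth_periodic_linear:
  assumes "smooth_periodic f" "smooth_periodic g"
  shows "smooth_periodic (\<lambda>t. a * f t + b * g t)"
  using assms unfolding smooth_periodic_def Dop_pow_linear[OF assms]
  by (auto intro: Dop_linear)

locale weight =
  fixes M :: "nat \<Rightarrow> real"
  assumes M_pos: "\<And>p. M p > 0" and M_0: "M 0 = 1"
begin

text \<open>The bridge from the \<open>ennreal\<close> seminorm to real inequalities, the form in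
  which the estimates below are made.\<close>

lemma unorm_le_iff:
  assumes "smooth_periodic g" "h > 0" "B \<ge> 0"
  shows "unorm M h g \<le> ennreal B \<longleftrightarrow> (\<forall>p t. h ^ p * cmod ((Dop ^^ p) g t) \<le> B * M p)"
proof -
  have "ennreal (h ^ p) * L / ennreal (M p) \<le> ennreal B \<longleftrightarrow> L \<le> ennreal (B * M p / h ^ p)" for p L
  proof (cases L)
    case (real l)
    have "ennreal (h ^ p) * L / ennreal (M p) = ennreal (h ^ p * l / M p)"
      using real M_pos[of p] assms by (simp add: ennreal_mult'[symmetric] divide_ennreal)
    then show ?thesis
      using real M_pos[of p] assms by (simp add: ennreal_le_iff field_simps)
  next
    case top
    then show ?thesis
      using M_pos[of p] assms by (simp add: ennreal_mult_top ennreal_top_divide top_unique)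
  qed
  then have "unorm M h g \<le> ennreal B \<longleftrightarrow> (\<forall>p. Linf_norm ((Dop ^^ p) g) \<le> ennreal (B * M p / h ^ p))"
    unfolding unorm_def by (simp add: SUP_le_iff)
  also have "\<dots> \<longleftrightarrow> (\<forall>p t. cmod ((Dop ^^ p) g t) \<le> B * M p / h ^ p)"
    using assms M_pos by (simp add: Linf_norm_le_iff smooth_Dop_pow(2) less_imp_le)
  finally show ?thesis using assms by (simp add: field_simps)
qed

lemma E_stepI:
  assumes "smooth_periodic g" "h > 0" "\<And>p t. h ^ p * cmod ((Dop ^^ p) g t) \<le> B * M p"
  shows "g \<in> E_step M h"
proof -
  \<comment> \<open>\<open>ennreal\<close> sends negative reals to 0, so \<open>B \<ge> 0\<close>
    has to be extracted; the case \<open>p = 0\<close> with \<open>M 0 = 1\<close> provides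
    it.\<close>
  have "0 \<le> cmod (g 0)" by simp
  also have "\<dots> \<le> B" using assms(3)[of 0 0] M_0 by simp
  finally have "unorm M h g \<le> ennreal B" using assms by (simp add: unorm_le_iff)
  then show ?thesis using assms(1) by (simp add: E_step_def order_le_less_trans)
qed

lemma E_stepD:
  assumes "g \<in> E_step M h" "h > 0"
  obtains B where "smooth_periodic g" "B \<ge> 0" "\<And>p t. h ^ p * cmod ((Dop ^^ p) g t) \<le> B * M p"
proof -
  have s: "smooth_periodic g" and "unorm M h g < \<infinity>" using assms by (auto simp: E_step_def)
  then obtain B where "B \<ge> 0" "unorm M h g = ennreal B" by (cases "unorm M h g") auto
  with s assms(2) show ?thesis using unorm_le_iff[of g h B] by (intro that[of B]) auto
qed

lemma E_step_linear:
  assumes "f \<in> E_step M h" "g \<in> E_step M h" "h > 0"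
  shows "(\<lambda>t. a * f t + b * g t) \<in> E_step M h"
proof -
  obtain A where f: "smooth_periodic f" "A \<ge> 0" "\<And>p t. h ^ p * cmod ((Dop ^^ p) f t) \<le> A * M p"
    by (rule E_stepD[OF assms(1,3)]) (rule that)
  obtain B where g: "smooth_periodic g" "B \<ge> 0" "\<And>p t. h ^ p * cmod ((Dop ^^ p) g t) \<le> B * M p"
    by (rule E_stepD[OF assms(2,3)]) (rule that)
  show ?thesis
  proof (rule E_stepI[OF smooth_periodic_linear[OF f(1) g(1)] assms(3)])
    fix p t
    have "h ^ p * cmod (a * (Dop ^^ p) f t + b * (Dop ^^ p) g t)
        \<le> h ^ p * (cmod a * cmod ((Dop ^^ p) f t) + cmod b * cmod ((Dop ^^ p) g t))"
      using assms(3) norm_triangle_ineq[of "a * (Dop ^^ p) f t" "b * (Dop ^^ p) g t"]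
      by (intro mult_left_mono) (simp_all add: norm_mult)
    also have "\<dots> = cmod a * (h ^ p * cmod ((Dop ^^ p) f t)) + cmod b * (h ^ p * cmod ((Dop ^^ p) g t))"
      by (simp add: algebra_simps)
    also have "\<dots> \<le> cmod a * (A * M p) + cmod b * (B * M p)"
      by (intro add_mono mult_left_mono f(3) g(3)) auto
    also have "\<dots> = (cmod a * A + cmod b * B) * M p" by (simp add: algebra_simps)
    finally show "h ^ p * cmod ((Dop ^^ p) (\<lambda>t. a * f t + b * g t) t) \<le> (cmod a * A + cmod b * B) * M p"
      by (simp add: Dop_pow_linear f(1) g(1))
  qed
qed

lemma E_step_antimono:
  assumes "0 < h" "h \<le> h'" shows "E_step M h' \<subseteq> E_step M h"
proof
  fix g assume "g \<in> E_step M h'"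
  then obtain B where B: "smooth_periodic g" "\<And>p t. h' ^ p * cmod ((Dop ^^ p) g t) \<le> B * M p"
    using E_stepD assms by (metis less_le_trans)
  show "g \<in> E_step M h"
  proof (rule E_stepI[OF B(1) assms(1)])
    fix p t
    have "h ^ p * cmod ((Dop ^^ p) g t) \<le> h' ^ p * cmod ((Dop ^^ p) g t)"
      using assms by (intro mult_right_mono power_mono) auto
    with B(2)[of p t] show "h ^ p * cmod ((Dop ^^ p) g t) \<le> B * M p" by simp
  qed
qed

lemma E_spaceD:
  assumes "g \<in> E_space s M"
  obtains h where "h > 0" "g \<in> E_step M h"
  using assms by (cases s) (auto intro: that[of 1])

lemma E_space_linear:
  assumes "f \<in> E_space s M" "g \<in> E_space s M"
  shows "(\<lambda>t. a * f t + b * g t) \<in> E_space s M"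
proof (cases s)
  case Beurling
  then show ?thesis using assms by (auto intro!: E_step_linear)
next
  case Roumieu
  obtain h h' where "h > 0" "f \<in> E_step M h" "h' > 0" "g \<in> E_step M h'"
    using assms by (meson E_spaceD)
  \<comment> \<open>Steps grow as the parameter shrinks, so the smaller one holds both
    functions.\<close>
  moreover define k where "k = min h h'"
  ultimately have k: "k > 0" "f \<in> E_step M k" "g \<in> E_step M k"
    using E_step_antimono[of k h] E_step_antimono[of k h'] by auto
  then show ?thesis using Roumieu E_step_linear[OF k(2,3,1)] by auto
qed

lemma E_space_cont:
  assumes "f \<in> E_space s M" shows "continuous_on S f" "smooth_periodic f"
proof -
  show s: "smooth_periodic f" using E_spaceD[OF assms] by (auto simp: E_step_def)
  show "continuous_on S f" using smooth_Dop_pow(2)[OF s, of 0] continuous_on_subset by auto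
qed

lemma abs_functional_le:
  assumes "continuous_on UNIV f" "\<And>t. cmod (f t) \<le> B" "g \<in> E_step M h" "h > 0"
    "unorm M h g \<le> ennreal e" "e \<ge> 0"
  shows "cmod (integral {0..2 * pi} (\<lambda>t. f t * g t)) \<le> 2 * pi * B * e"
proof -
  have s: "smooth_periodic g" using assms(3) by (simp add: E_step_def)
  \<comment> \<open>The term \<open>p = 0\<close> with \<open>M 0 = 1\<close> shows that the
    seminorm dominates the sup norm.\<close>
  have g: "cmod (g t) \<le> e" for t
    using unorm_le_iff[OF s assms(4,6)] assms(5) M_0 by (metis funpow_0 mult.right_neutral mult_1 power_0)
  have "cmod (f t * g t) \<le> B * e" for t
    unfolding norm_mult using assms(2)[of t] g[of t] by (intro mult_mono) (auto intro: order_trans[OF norm_ge_zero])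
  then have "cmod (integral {0..2 * pi} (\<lambda>t. f t * g t)) \<le> B * e * (2 * pi - 0)"
    using smooth_Dop_pow(2)[OF s, of 0]
    by (intro integral_bound continuous_intros) (auto intro: continuous_on_subset[OF assms(1)] continuous_on_subset)
  then show ?thesis by (simp add: mult_ac)
qed

lemma openin_step_preimage:
  assumes f: "continuous_on UNIV f" "\<And>t. cmod (f t) \<le> B" and "h > 0" "open U"
  shows "openin (step_topology M h) {g \<in> E_step M h. integral {0..2 * pi} (\<lambda>t. f t * g t) \<in> U}"
    (is "openin _ {g \<in> _. ?L g \<in> U}")
  unfolding openin_step_topology
proof (intro conjI ballI)
  fix g assume g: "g \<in> {g \<in> E_step M h. ?L g \<in> U}"
  then obtain d where d: "d > 0" "ball (?L g) d \<subseteq> U"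
    using \<open>open U\<close> open_contains_ball by blast
  have B: "B \<ge> 0" using f(2)[of 0] norm_ge_zero order_trans by blast
  \<comment> \<open>\<open>B + 1\<close> keeps the quotient defined for \<open>B = 0\<close> and
    makes the final inequality strict.\<close>
  define e where "e = d / (2 * pi * (B + 1))"
  have e: "e > 0" using d B by (simp add: e_def)
  have "2 * pi * B * e = d * (B / (B + 1))"
    using B by (simp add: e_def)
  also have "\<dots> < d * 1"
    using d B by (intro mult_strict_left_mono) auto
  finally have le: "2 * pi * B * e < d" by simp
  have "g' \<in> {g \<in> E_step M h. ?L g \<in> U}" if g': "g' \<in> E_step M h" "unorm M h (\<lambda>t. g' t - g t) < ennreal e" for g'
  proof -
    have "(\<lambda>t. g' t - g t) \<in> E_step M h" using E_step_linear[of g' h g 1 "-1"] g g' \<open>h > 0\<close> by simp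
    then have "cmod (?L (\<lambda>t. g' t - g t)) \<le> 2 * pi * B * e"
      using abs_functional_le[OF f] g' e \<open>h > 0\<close> by (meson less_imp_le)
    moreover have c: "continuous_on S (\<lambda>t. f t * k t)" if "k \<in> E_step M h" for S k
    proof -
      have "continuous_on UNIV k" using that smooth_Dop_pow(2)[of k 0] by (simp add: E_step_def)
      with f(1) have "continuous_on UNIV (\<lambda>t. f t * k t)" by (intro continuous_on_mult)
      then show ?thesis using continuous_on_subset by blast
    qed
    have "?L (\<lambda>t. g' t - g t) = ?L g' - ?L g"
      unfolding right_diff_distrib using g g'
      by (intro integral_diff integrable_continuous_real c) auto
    ultimately have "dist (?L g) (?L g') < d"
      using le by (simp add: dist_norm norm_minus_commute)
    then show ?thesis using d g' by auto
  qed
  with e show "\<exists>e>0. \<forall>g'\<in>E_step M h. unorm M h (\<lambda>t. g' t - g t) < ennreal e \<longrightarrow> g' \<in> {g \<in> E_step M h. ?L g \<in> U}"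
    by blast
qed auto

end

section \<open>The associated function and the dual\<close>

lemma eexp_infinity [simp]: "eexp \<infinity> = \<infinity>" "eexp (- \<infinity>) = 0"
  by (simp_all only: infinity_ereal_def uminus_ereal.simps eexp.simps)

lemma eexp_ge_1: "a \<ge> 0 \<Longrightarrow> 1 \<le> eexp a"
  using ennreal_leI[of 1] by (cases a) auto

lemma eexp_uminus_le_1: "a \<ge> 0 \<Longrightarrow> eexp (- a) \<le> 1"
  using ennreal_leI[of _ 1] by (cases a) auto

lemma integral_mult_linear:
  fixes f g k :: "real \<Rightarrow> complex"
  assumes "continuous_on {c..d} f" "continuous_on {c..d} g" "continuous_on {c..d} k"
  shows "integral {c..d} (\<lambda>t. f t * (a * g t + b * k t)) =
    a * integral {c..d} (\<lambda>t. f t * g t) + b * integral {c..d} (\<lambda>t. f t * k t)"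
proof -
  have "(\<lambda>t. f t * g t) integrable_on {c..d}" "(\<lambda>t. f t * k t) integrable_on {c..d}"
    by (intro integrable_continuous_real continuous_on_mult assms)+
  then have "((\<lambda>t. a * (f t * g t) + b * (f t * k t)) has_integral
      a * integral {c..d} (\<lambda>t. f t * g t) + b * integral {c..d} (\<lambda>t. f t * k t)) {c..d}"
    by (intro has_integral_add has_integral_mult_right integrable_integral)
  then show ?thesis by (simp add: integral_unique algebra_simps)
qed

text \<open>The conclusion is restricted to finite \<open>a n\<close>: at an infinite weight the
  factor is 0 and the supremum carries no information about \<open>u n\<close>.\<close>

lemma SUP_eexp_uminus:
  assumes "(SUP n. u n * eexp (- a n)) < \<infinity>"
  obtains C where "C \<ge> 0" "\<And>n r. a n = ereal r \<Longrightarrow> u n \<le> ennreal (C * exp r)"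
proof -
  obtain C where C: "C \<ge> 0" "(SUP n. u n * eexp (- a n)) = ennreal C"
    using assms by (cases "SUP n. u n * eexp (- a n)") auto
  have "u n \<le> ennreal (C * exp r)" if "a n = ereal r" for n r
  proof -
    have "u n * ennreal (exp (- r)) \<le> ennreal C"
      using SUP_upper[of n UNIV "\<lambda>n. u n * eexp (- a n)"] that C(2) by simp
    then have "u n * ennreal (exp (- r)) * ennreal (exp r) \<le> ennreal C * ennreal (exp r)"
      by (rule mult_right_mono) simp
    then show ?thesis
      using C(1) by (simp add: mult.assoc ennreal_mult'[symmetric] exp_minus)
  qed
  with C(1) show ?thesis by (rule that)
qed

lemma SUP_eexp_bounded:
  assumes "(SUP n. u n * eexp (a n)) < \<infinity>" "\<And>n. a n \<ge> 0"
  obtains C where "C \<ge> 0" "\<And>n. u n \<le> ennreal C"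
proof -
  obtain C where C: "C \<ge> 0" "(SUP n. u n * eexp (a n)) = ennreal C"
    using assms by (cases "SUP n. u n * eexp (a n)") auto
  have "u n \<le> u n * eexp (a n)" for n
    using mult_left_mono[OF eexp_ge_1[OF assms(2)], of "u n" n] by simp
  then have "u n \<le> ennreal C" for n
    using SUP_upper[of n UNIV "\<lambda>n. u n * eexp (a n)"] C(2) by (metis UNIV_I order_trans)
  with C(1) show ?thesis by (rule that)
qed

context weight
begin

text \<open>Replaces the supremum of logarithms by power inequalities. At \<open>t = 0\<close>,
  where the value is set separately, the equivalence rests on the inequality for
  \<open>p = 0\<close> and \<open>M 0 = 1\<close>.\<close>

lemma assoc_le_iff: "assoc M t \<le> ereal a \<longleftrightarrow> (\<forall>p. \<bar>t\<bar> ^ p \<le> exp a * M p)"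
proof (cases "t = 0")
  case True
  have "(\<forall>p. 0 ^ p \<le> exp a * M p) \<longleftrightarrow> 0 \<le> a"
  proof
    assume "\<forall>p. 0 ^ p \<le> exp a * M p"
    from spec[OF this, of 0] show "0 \<le> a" by (simp add: M_0)
  next
    assume "0 \<le> a"
    then show "\<forall>p. 0 ^ p \<le> exp a * M p"
      using M_0 M_pos by (auto simp: power_0_left less_imp_le)
  qed
  with True show ?thesis by (simp add: assoc_def)
next
  case False
  have "ln (\<bar>t\<bar> ^ p / M p) \<le> a \<longleftrightarrow> \<bar>t\<bar> ^ p \<le> exp a * M p" for p
  proof -
    have "\<bar>t\<bar> ^ p / M p > 0" using False M_pos by simp
    then have "ln (\<bar>t\<bar> ^ p / M p) \<le> a \<longleftrightarrow> \<bar>t\<bar> ^ p / M p \<le> exp a"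
      by (metis exp_le_cancel_iff exp_ln)
    then show ?thesis using M_pos[of p] by (simp add: field_simps)
  qed
  with False show ?thesis by (simp add: assoc_def SUP_le_iff)
qed

lemma assoc_nonneg: "0 \<le> assoc M t"
proof (cases "t = 0")
  case False
  have "ereal (ln (\<bar>t\<bar> ^ 0 / M 0)) \<le> (SUP p. ereal (ln (\<bar>t\<bar> ^ p / M p)))"
    by (rule SUP_upper) simp
  with False show ?thesis by (simp add: assoc_def M_0 zero_ereal_def)
qed (simp add: assoc_def)

lemma assoc_finite_mono:
  assumes "assoc M y = ereal r" "\<bar>x\<bar> \<le> \<bar>y\<bar>"
  obtains r' where "assoc M x = ereal r'" "r' \<le> r"
proof -
  have "\<bar>x\<bar> ^ p \<le> exp r * M p" for p
    using power_mono[OF assms(2), of p] assoc_le_iff[of y r] assms(1) by (auto intro: order_trans)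
  then have "assoc M x \<le> ereal r" by (simp add: assoc_le_iff)
  then show ?thesis using assoc_nonneg[of x] by (cases "assoc M x") (auto intro: that)
qed

lemma assoc_finite:
  assumes "\<And>p. \<bar>x\<bar> ^ p \<le> C * M p"
  obtains r where "assoc M x = ereal r"
proof -
  have "C > 0" using assms[of 0] M_0 by simp
  then have "assoc M x \<le> ereal (ln C)" using assms by (simp add: assoc_le_iff)
  then show ?thesis using assoc_nonneg[of x] by (cases "assoc M x") (auto intro: that)
qed

lemma unorm_mono:
  assumes "0 < h" "h \<le> h'" shows "unorm M h g \<le> unorm M h' g"
  unfolding unorm_def using assms
  by (intro SUP_mono') (intro divide_right_mono_ennreal mult_right_mono ennreal_leI power_mono; simp)

lemma openin_E_preimage:
  assumes f: "continuous_on UNIV f" "\<And>t. cmod (f t) \<le> B" and "open U"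
  shows "openin (E_topology s M) {g \<in> E_space s M. integral {0..2 * pi} (\<lambda>t. f t * g t) \<in> U}"
    (is "openin _ {g \<in> _. ?L g \<in> U}")
proof (cases s)
  case Beurling
  \<comment> \<open>The functional is already continuous on the step with \<open>h = 1\<close>,
    whose open sets have traces among the generators.\<close>
  have "{g \<in> E_space Beurling M. ?L g \<in> U} = E_space Beurling M \<inter> {g \<in> E_step M 1. ?L g \<in> U}"
    by auto
  then show ?thesis
    using Beurling openin_step_preimage[OF f, of 1 U] assms(3) unfolding Beurling E_topology.simps
    by (intro topology_generated_by_Basis) (auto intro!: exI[of _ "{g \<in> E_step M 1. ?L g \<in> U}"] exI[of _ "1::real"])
next
  case Roumieu
  let ?E = "E_space Roumieu M"
  have lin: "?L (\<lambda>t. a * g t + b * k t) = a * ?L g + b * ?L k" if "g \<in> ?E" "k \<in> ?E" for a b g k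
    by (intro integral_mult_linear E_space_cont[OF that(1)] E_space_cont[OF that(2)] continuous_on_subset[OF f(1)]) simp
  show ?thesis
    unfolding Roumieu openin_E_topology_Roumieu
  proof (intro conjI ballI)
    fix g assume "g \<in> {g \<in> ?E. ?L g \<in> U}"
    then have g: "g \<in> ?E" and gU: "?L g \<in> U" by blast+
    obtain d where d: "d > 0" "ball (?L g) d \<subseteq> U"
      by (rule openE[OF \<open>open U\<close> gU]) (rule that)
    \<comment> \<open>The preimage of a ball around 0 is absolutely convex and open in each step;
      linearity translates it to \<open>g\<close>.\<close>
    let ?V = "{k \<in> ?E. ?L k \<in> ball 0 d}"
    have "abs_convex ?V"
      unfolding abs_convex_def
    proof (intro ballI allI impI)
      fix k l :: "real \<Rightarrow> complex" and a b :: complex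
      assume k: "k \<in> ?V" and l: "l \<in> ?V" and ab: "cmod a + cmod b \<le> 1"
      define m where "m = max (cmod (?L k)) (cmod (?L l))"
      have m: "0 \<le> m" "m < d" using k l by (auto simp: m_def le_max_iff_disj)
      have kl: "k \<in> ?E" "l \<in> ?E" using k l by blast+
      have "cmod (?L (\<lambda>t. a * k t + b * l t)) \<le> cmod a * cmod (?L k) + cmod b * cmod (?L l)"
        unfolding lin[OF kl] norm_mult[symmetric] by (rule norm_triangle_ineq)
      also have "\<dots> \<le> cmod a * m + cmod b * m"
        by (intro add_mono mult_left_mono) (auto simp: m_def)
      also have "\<dots> \<le> 1 * m"
        unfolding distrib_right[symmetric] using ab m by (intro mult_right_mono)
      finally show "(\<lambda>t. a * k t + b * l t) \<in> ?V"
        using E_space_linear[OF kl, of a b] m by (simp del: E_space.simps)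
    qed
    moreover have "\<exists>W. openin (step_topology M h) W \<and> (\<lambda>t. 0) \<in> W \<and> W \<subseteq> ?V" if "h > 0" for h
    proof (intro exI conjI)
      show "openin (step_topology M h) {k \<in> E_step M h. ?L k \<in> ball 0 d}"
        by (intro openin_step_preimage[OF f that] open_ball)
      have "(\<lambda>t. 0) \<in> E_step M h"
      proof -
        have "rapid (\<lambda>k. 0)" by (rule rapid_finite_support[of "{}"]) auto
        then show ?thesis
          using smooth_periodic_trig[of "\<lambda>k. 0"] Dop_pow_trig[of "\<lambda>k. 0"]
          by (intro E_stepI[where B = 0]) (auto simp: trig_def[abs_def] that)
      qed
      then show "(\<lambda>t. 0) \<in> {k \<in> E_step M h. ?L k \<in> ball 0 d}" using d by simp
    qed (use that in auto)
    moreover have "(\<lambda>t. g t + k t) \<in> {g \<in> ?E. ?L g \<in> U}" if k: "k \<in> ?V" for k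
    proof -
      have "?L (\<lambda>t. g t + k t) = ?L g + ?L k" using lin[of g k 1 1] g k by (simp del: E_space.simps)
      then have "?L (\<lambda>t. g t + k t) \<in> ball (?L g) d" using k by (simp add: dist_norm del: E_space.simps)
      then show ?thesis using d(2) E_space_linear[of g Roumieu k 1 1] g k by (auto simp del: E_space.simps)
    qed
    moreover have "?V \<subseteq> ?E" by blast
    ultimately show "\<exists>V\<subseteq>?E. abs_convex V \<and> (\<forall>h>0. \<exists>W. openin (step_topology M h) W \<and> (\<lambda>t. 0) \<in> W \<and> W \<subseteq> V) \<and>
        (\<forall>k\<in>V. (\<lambda>t. g t + k t) \<in> {g \<in> ?E. ?L g \<in> U})"
      by (intro exI[of _ ?V]) blast
  qed auto
qed

lemma topspace_E_topology_subset: "topspace (E_topology s M) \<subseteq> E_space s M"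
proof (cases s)
  case Beurling
  then show ?thesis by (auto simp: topology_generated_by_topspace)
next
  case Roumieu
  then show ?thesis using openin_E_topology_Roumieu[of M "topspace (E_topology Roumieu M)"] by auto
qed

lemma functional_of_in_E_dual:
  assumes f: "f \<in> E_space s M"
  shows "functional_of s M f \<in> E_dual s M"
proof -
  let ?L = "\<lambda>g. integral {0..2 * pi} (\<lambda>t. f t * g t)"
  have fc: "continuous_on UNIV f" and fs: "smooth_periodic f" using E_space_cont[OF f] by auto
  then obtain B where B: "\<And>t. cmod (f t) \<le> B"
    using periodic_bounded[OF fc] smooth_periodic_def by metis
  note op = openin_E_preimage[OF fc B, of _ s]
  \<comment> \<open>With \<open>U = UNIV\<close> the preimage is the whole space, which is therefore
    open.\<close>
  have top: "topspace (E_topology s M) = E_space s M"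
    using topspace_E_topology_subset openin_subset[OF op[of UNIV]] by auto
  have "?L (\<lambda>t. a * g t + b * k t) = a * ?L g + b * ?L k"
    if "g \<in> E_space s M" "k \<in> E_space s M" for a b g k
    by (intro integral_mult_linear E_space_cont[OF that(1)] E_space_cont[OF that(2)] E_space_cont[OF f])
  moreover have "continuous_map (E_topology s M) euclidean (functional_of s M f)"
    unfolding continuous_map_def
  proof (intro conjI allI impI)
    fix U :: "complex set" assume "openin euclidean U"
    then have "open U" by simp
    from op[OF this] show "openin (E_topology s M) {g \<in> topspace (E_topology s M). functional_of s M f g \<in> U}"
      unfolding top functional_of_def by (rule back_subst[of "openin _"]) auto
  qed auto
  ultimately show ?thesis
    by (simp add: E_dual_def functional_of_def E_space_linear)
qed

end

section \<open>Decay of Fourier coefficients\<close>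

locale weight_M2 = weight +
  fixes A H :: real
  assumes A_ge_1: "A \<ge> 1" and H_ge_1: "H \<ge> 1"
    and M2: "\<And>p q. M (p + q) \<le> A * H ^ (p + q) * M p * M q"
begin

text \<open>For \<open>h > 0\<close> this is |b k| <= C exp (- M (h k)) with the supremum over q
  written out; if M (h k) is infinite it says b k = 0.\<close>

definition decay_bound :: "real \<Rightarrow> real \<Rightarrow> (int \<Rightarrow> complex) \<Rightarrow> bool" where
  "decay_bound C h b \<longleftrightarrow> (\<forall>k q. cmod (b k) * (h * \<bar>of_int k\<bar>) ^ q \<le> C * M q)"

definition decay :: "kind \<Rightarrow> (int \<Rightarrow> complex) \<Rightarrow> bool" where
  "decay s b \<longleftrightarrow> (case s of Beurling \<Rightarrow> \<forall>h>0. \<exists>C. decay_bound C h b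
                   | Roumieu \<Rightarrow> \<exists>h>0. \<exists>C. decay_bound C h b)"

lemma decay_bound_nonneg: "decay_bound C h b \<Longrightarrow> C \<ge> 0"
  unfolding decay_bound_def using M_0
  by (metis mult.right_neutral norm_ge_zero order_trans power_0)

lemma decay_bound_mult:
  assumes "decay_bound C h b" "\<And>k. cmod (c k) \<le> D"
  shows "decay_bound (D * C) h (\<lambda>k. c k * b k)"
  unfolding decay_bound_def
proof (intro allI)
  fix k q
  have D: "D \<ge> 0" using assms(2)[of 0] norm_ge_zero order_trans by blast
  have "cmod (c k * b k) * (h * \<bar>of_int k\<bar>) ^ q = cmod (c k) * (cmod (b k) * (h * \<bar>of_int k\<bar>) ^ q)"
    by (simp add: norm_mult)
  also have "\<dots> \<le> cmod (c k) * (C * M q)"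
    using assms(1) by (intro mult_left_mono) (auto simp: decay_bound_def)
  also have "\<dots> \<le> D * (C * M q)"
    using assms(2)[of k] decay_bound_nonneg[OF assms(1)] M_pos[of q] by (intro mult_right_mono) auto
  finally show "cmod (c k * b k) * (h * \<bar>of_int k\<bar>) ^ q \<le> D * C * M q" by (simp add: mult.assoc)
qed

lemma decay_BeurlingD:
  assumes "decay Beurling b" "h > 0" obtains C where "decay_bound C h b"
  using assms unfolding decay_def by auto

lemma decayD:
  assumes "decay s b" obtains h C where "h > 0" "decay_bound C h b"
proof (cases s)
  case Beurling
  with assms obtain C where "decay_bound C 1 b"
    by (metis decay_BeurlingD zero_less_one)
  then show ?thesis by (rule that[OF zero_less_one])
next
  case Roumieu
  with assms show ?thesis by (auto simp: decay_def intro: that)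
qed

lemma decay_mono:
  assumes "decay s b" "\<And>h C. h > 0 \<Longrightarrow> decay_bound C h b \<Longrightarrow> \<exists>C'. decay_bound C' h b'"
  shows "decay s b'"
  using assms by (cases s) (simp_all add: decay_def, blast+)

lemma decay_mult:
  assumes "decay s b" "\<And>k. cmod (c k) \<le> D" shows "decay s (\<lambda>k. c k * b k)"
  using assms(1) by (rule decay_mono) (rule exI, rule decay_bound_mult[OF _ assms(2)])

lemma decay_bound_antimono:
  assumes "decay_bound C h b" "0 < h'" "h' \<le> h" shows "decay_bound C h' b"
  unfolding decay_bound_def
proof (intro allI)
  fix k q
  have "cmod (b k) * (h' * \<bar>of_int k\<bar>) ^ q \<le> cmod (b k) * (h * \<bar>of_int k\<bar>) ^ q"
    using assms by (intro mult_left_mono power_mono mult_right_mono) auto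
  also have "\<dots> \<le> C * M q" using assms(1) by (simp add: decay_bound_def)
  finally show "cmod (b k) * (h' * \<bar>of_int k\<bar>) ^ q \<le> C * M q" .
qed

lemma decay_boundD:
  assumes "decay_bound C h b" "h > 0"
  shows "cmod (b k) * \<bar>of_int k\<bar> ^ q \<le> C * M q / h ^ q"
  using assms by (simp add: decay_bound_def power_mult_distrib field_simps)

lemma rapid_decay_bound: "decay_bound C h b \<Longrightarrow> h > 0 \<Longrightarrow> rapid b"
  unfolding rapid_def using decay_boundD by blast

text \<open>\<open>2 * trig_const\<close> comes from \<open>trig_bound\<close>; in the bracket, 1
  covers the plain bound on the coefficients of the p-th derivative and the other summand the bound
  with k^2, after (M.2) with \<open>q = 2\<close>.\<close>

definition trig_factor :: "real \<Rightarrow> real" where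
  "trig_factor h = 2 * trig_const * (1 + A * H\<^sup>2 * M 2 / h\<^sup>2)"

lemma trig_factor_nonneg: "h > 0 \<Longrightarrow> trig_factor h \<ge> 0"
  unfolding trig_factor_def using trig_const_nonneg A_ge_1 M_pos[of 2] by simp

text \<open>Absolute convergence needs decay of order p + 2. (M.2) brings \<open>M (p + 2)\<close>
  back to \<open>M p\<close>, and its factor H^p is what turns the scale \<open>h\<close> into
  \<open>h / H\<close>.\<close>

lemma decay_bound_trig:
  assumes b: "decay_bound C h b" and "h > 0"
  shows "(h / H) ^ p * cmod ((Dop ^^ p) (trig b) t) \<le> C * trig_factor h * M p"
proof -
  note C = decay_bound_nonneg[OF b]
  define B where "B = C * M p * H ^ p / h ^ p * (1 + A * H\<^sup>2 * M 2 / h\<^sup>2)"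
  have H1: "1 \<le> H ^ q" for q using H_ge_1 by simp
  have "cmod (trig (\<lambda>k. b k * of_int k ^ p) t) \<le> 2 * B * trig_const"
  proof (rule trig_bound)
    fix k
    have "cmod (b k * of_int k ^ p) \<le> C * M p / h ^ p"
      using decay_boundD[OF assms, of k p] by (simp add: norm_mult norm_power)
    also have "\<dots> = (C * M p / h ^ p) * 1 * 1" by simp
    also have "\<dots> \<le> (C * M p / h ^ p) * H ^ p * (1 + A * H\<^sup>2 * M 2 / h\<^sup>2)"
      using C H1 A_ge_1 M_pos \<open>h > 0\<close> less_imp_le[OF M_pos]
      by (intro mult_mono mult_nonneg_nonneg divide_nonneg_nonneg) (auto intro: order_trans[OF zero_le_one])
    finally show "cmod (b k * of_int k ^ p) \<le> B" by (simp add: B_def)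
    have "cmod (b k * of_int k ^ p) * \<bar>of_int k\<bar> ^ 2 \<le> C * M (p + 2) / h ^ (p + 2)"
      using decay_boundD[OF assms, of k "p + 2"] by (simp only: norm_mult norm_power norm_of_int power_add mult.assoc)
    also have "\<dots> \<le> C * (A * H ^ (p + 2) * M p * M 2) / h ^ (p + 2)"
      using C M2[of p 2] \<open>h > 0\<close> by (intro divide_right_mono mult_left_mono) auto
    also have "\<dots> = C * M p * H ^ p / h ^ p * (A * H\<^sup>2 * M 2 / h\<^sup>2)"
      by (simp add: power_add power2_eq_square field_simps)
    also have "\<dots> \<le> B"
      unfolding B_def using C less_imp_le[OF M_pos] H_ge_1 \<open>h > 0\<close>
      by (intro mult_left_mono mult_nonneg_nonneg divide_nonneg_nonneg) auto
    finally show "cmod (b k * of_int k ^ p) * \<bar>of_int k\<bar> ^ 2 \<le> B" .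
  qed
  then have "(h / H) ^ p * cmod ((Dop ^^ p) (trig b) t) \<le> (h / H) ^ p * (2 * B * trig_const)"
    using H_ge_1 \<open>h > 0\<close> unfolding Dop_pow_trig[OF rapid_decay_bound[OF assms]]
    by (intro mult_left_mono) auto
  also have "\<dots> = C * trig_factor h * M p"
    using H_ge_1 \<open>h > 0\<close> by (simp add: B_def trig_factor_def power_divide)
  finally show ?thesis .
qed

lemma decay_bound_unorm_trig:
  assumes "decay_bound C h b" "h > 0"
  shows "unorm M (h / H) (trig b) \<le> ennreal (C * trig_factor h)" "trig b \<in> E_step M (h / H)"
proof -
  have s: "smooth_periodic (trig b)" using rapid_decay_bound[OF assms] by (rule smooth_periodic_trig)
  have h: "h / H > 0" using assms H_ge_1 by simp
  show "unorm M (h / H) (trig b) \<le> ennreal (C * trig_factor h)"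
    using unorm_le_iff[OF s h] decay_bound_trig[OF assms] decay_bound_nonneg[OF assms(1)] trig_factor_nonneg[OF assms(2)]
    by simp
  then show "trig b \<in> E_step M (h / H)" using s by (simp add: E_step_def order_le_less_trans)
qed

lemma decay_trig:
  assumes "decay s b" shows "rapid b" "trig b \<in> E_space s M"
proof -
  have H: "H > 0" using H_ge_1 by simp
  show "rapid b"
    using assms rapid_decay_bound by (blast elim: decayD)
  show "trig b \<in> E_space s M"
  proof (cases s)
    case Beurling
    have "trig b \<in> E_step M h" if h: "h > 0" for h
    proof -
      \<comment> \<open>Starting from \<open>h * H\<close> makes up for the division by
        \<open>H\<close> in \<open>decay_bound_unorm_trig\<close>.\<close>
      obtain C where "decay_bound C (h * H) b"
        using decay_BeurlingD[of b "h * H"] assms(1) h H Beurling by auto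
      from decay_bound_unorm_trig(2)[OF this] show ?thesis using h H by simp
    qed
    then show ?thesis using Beurling by auto
  next
    case Roumieu
    then obtain h C where "h > 0" "decay_bound C h b" using assms by (auto simp: decay_def)
    then have "h / H > 0" "trig b \<in> E_step M (h / H)" using H decay_bound_unorm_trig(2) by auto
    then show ?thesis using Roumieu by auto
  qed
qed

text \<open>Each derivative contributes a factor k to the coefficient, so in this direction the
  scale \<open>h\<close> is kept.\<close>

lemma decay_bound_fourier_coeff:
  assumes "g \<in> E_step M h" "h > 0"
  obtains C where "decay_bound C h (fourier_coeff g)"
proof -
  obtain B where B: "smooth_periodic g" "B \<ge> 0" "\<And>p t. h ^ p * cmod ((Dop ^^ p) g t) \<le> B * M p"
    by (rule E_stepD[OF assms]) (rule that)
  have "cmod (fourier_coeff g k) * (h * \<bar>of_int k\<bar>) ^ q \<le> B * M q" for k q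
  proof -
    have "cmod (fourier_coeff g k) * \<bar>of_int k\<bar> ^ q \<le> B * M q / h ^ q"
      using B(3)[of q] assms(2) by (intro norm_fourier_coeff_pow_le B(1)) (simp add: field_simps)
    then show ?thesis using assms(2) by (simp add: power_mult_distrib field_simps)
  qed
  then show ?thesis by (intro that[of B]) (simp add: decay_bound_def)
qed

lemma decay_fourier_coeff:
  assumes "g \<in> E_space s M" shows "decay s (fourier_coeff g)"
proof (cases s)
  case Beurling
  have "\<exists>C. decay_bound C h (fourier_coeff g)" if "h > 0" for h
  proof -
    have "g \<in> E_step M h" using assms that Beurling by simp
    from decay_bound_fourier_coeff[OF this that] show ?thesis by blast
  qed
  then show ?thesis using Beurling by (simp add: decay_def)
next
  case Roumieu
  obtain h where h: "h > 0" "g \<in> E_step M h" using assms by (rule E_spaceD)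
  obtain C where "decay_bound C h (fourier_coeff g)"
    by (rule decay_bound_fourier_coeff[OF h(2,1)])
  with h(1) show ?thesis using Roumieu by (auto simp: decay_def)
qed

text \<open>Bounded multipliers preserve the decay bound, so the seminorms are bounded uniformly in
  \<open>n\<close>; the weights \<open>eexp (- assoc M (\<mu> * real n))\<close> are at most 1 for
  every \<mu>.\<close>

lemma trig_regular:
  assumes "decay s b" "\<And>n k. cmod (c n k) \<le> D"
  shows "(\<lambda>n. trig (\<lambda>k. c n k * b k)) \<in> regular_seqs s M"
proof -
  have H: "H > 0" using H_ge_1 by simp
  have fin: "(SUP n. unorm M (h / H) (trig (\<lambda>k. c n k * b k)) * eexp (- assoc M (\<mu> * real n))) < \<infinity>"
    if b: "decay_bound C h b" "h > 0" for C h \<mu>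
  proof -
    have "unorm M (h / H) (trig (\<lambda>k. c n k * b k)) * eexp (- assoc M (\<mu> * real n))
        \<le> ennreal (D * C * trig_factor h) * 1" for n
      by (intro mult_mono decay_bound_unorm_trig decay_bound_mult b assms(2) eexp_uminus_le_1 assoc_nonneg) auto
    then have "(SUP n. unorm M (h / H) (trig (\<lambda>k. c n k * b k)) * eexp (- assoc M (\<mu> * real n)))
        \<le> ennreal (D * C * trig_factor h)"
      by (simp add: SUP_le_iff)
    then show ?thesis by (rule order_le_less_trans) simp
  qed
  have E: "trig (\<lambda>k. c n k * b k) \<in> E_space s M" for n
    by (rule decay_trig(2)[OF decay_mult[OF assms(1) assms(2)]])
  show ?thesis
  proof (cases s)
    case Beurling
    have "(SUP n. unorm M h (trig (\<lambda>k. c n k * b k)) * eexp (- assoc M (1 * real n))) < \<infinity>" if h: "h > 0" for h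
    proof -
      obtain C where "decay_bound C (h * H) b"
        using decay_BeurlingD[of b "h * H"] assms(1) h H Beurling by auto
      from fin[OF this, of 1] show ?thesis using h H by simp
    qed
    then show ?thesis using E Beurling zero_less_one
      unfolding Beurling regular_seqs.simps by blast
  next
    case Roumieu
    then obtain h C where h: "h > 0" "decay_bound C h b" using assms(1) by (auto simp: decay_def)
    then have "h / H > 0" using H by simp
    with fin[OF h(2,1)] show ?thesis using E Roumieu
      unfolding Roumieu regular_seqs.simps by blast
  qed
qed

text \<open>Splitting off the factor \<open>M r\<close> from \<open>M (q + r)\<close> and taking the infimum over \<open>r\<close> trades the growth
  \<open>exp r0 = exp (assoc M (h / H * x))\<close> for the constant \<open>H\<close> in the scale.\<close>

lemma absorb_assoc:
  assumes "a \<ge> 0" "x \<ge> 0" "h > 0" "assoc M (h / H * x) = ereal r0"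
    and le: "\<And>p. a * (h * x) ^ p \<le> C * exp r0 * M p"
  shows "a * (h / H * x) ^ q \<le> A * C * M q"
proof (cases "a * (h / H * x) ^ q = 0")
  case True
  have "0 \<le> C * exp r0" using le[of 0] assms(1) M_0 by simp
  then have "C \<ge> 0" by (simp add: zero_le_mult_iff)
  then show ?thesis unfolding True using A_ge_1 M_pos[of q] by simp
next
  case False
  define y where "y = h / H * x"
  define c where "c = a * y ^ q"
  have H: "H > 0" using H_ge_1 by simp
  have y: "y \<ge> 0" using assms H by (simp add: y_def)
  have "c \<noteq> 0" using False by (simp only: c_def y_def not_False_eq_True)
  moreover have "c \<ge> 0" using assms(1) y by (simp add: c_def)
  ultimately have c: "c > 0" by simp
  have "0 \<le> C * exp r0" using le[of 0] assms(1) M_0 by simp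
  then have C: "C \<ge> 0" by (simp add: zero_le_mult_iff)
  have yr: "\<bar>y\<bar> ^ r \<le> C * exp r0 * A * M q / c * M r" for r
  proof -
    \<comment> \<open>The power of \<open>H\<close> hidden in \<open>y\<close> cancels the one
      produced by (M.2).\<close>
    have "c * y ^ r = a * (h * x) ^ (q + r) / H ^ (q + r)"
      by (simp add: c_def y_def power_add power_mult_distrib power_divide)
    also have "\<dots> \<le> C * exp r0 * M (q + r) / H ^ (q + r)"
      using le H by (intro divide_right_mono) auto
    also have "\<dots> \<le> C * exp r0 * (A * H ^ (q + r) * M q * M r) / H ^ (q + r)"
      using C M2 H by (intro divide_right_mono mult_left_mono) auto
    also have "\<dots> = C * exp r0 * A * M q * M r" using H by simp
    finally show ?thesis using c y by (simp add: field_simps)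
  qed
  define K where "K = C * exp r0 * A * M q / c"
  have "K > 0" using yr[of 0] M_0 by (simp add: K_def)
  then have "assoc M y \<le> ereal (ln K)" using yr by (simp add: assoc_le_iff K_def)
  \<comment> \<open>\<open>assoc M y\<close> is \<open>r0\<close> and is bounded by
    \<open>ln K\<close>; as \<open>K\<close> contains \<open>exp r0\<close> as a factor, it cancels
    and leaves the bound on \<open>c\<close>.\<close>
  then have "exp r0 \<le> K" using assms(4) \<open>K > 0\<close> by (simp add: y_def ln_ge_iff)
  then have "exp r0 * c \<le> exp r0 * (A * C * M q)" using c by (simp add: K_def field_simps)
  then show ?thesis by (simp add: c_def y_def)
qed

text \<open>For each k only the term \<open>n = nat \<bar>k\<bar>\<close> is inspected. If
  \<open>assoc M\<close> is finite at \<open>h / H * real n\<close>, its exponential is absorbed by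
  \<open>absorb_assoc\<close>; otherwise \<open>b k\<close> is shown to vanish.\<close>

lemma decay_bound_regular:
  assumes h: "h > 0" and w: "\<And>n. w n \<in> E_step M h"
    and bound: "\<And>n r0 p t. assoc M (h / H * real n) = ereal r0 \<Longrightarrow>
      h ^ p * cmod ((Dop ^^ p) (w n) t) \<le> C * exp r0 * M p"
    and C: "C \<ge> 0"
    and b: "\<And>k. cmod (b k) \<le> D * cmod (fourier_coeff (w (nat \<bar>k\<bar>)) k)" and D: "D \<ge> 0"
  shows "decay_bound (A * (D * C)) (h / H) b"
  unfolding decay_bound_def
proof (intro allI)
  fix k q
  define n where "n = nat \<bar>k\<bar>"
  have n: "real n = \<bar>of_int k\<bar>" by (simp add: n_def)
  have H: "H > 0" using H_ge_1 by simp
  have s: "smooth_periodic (w n)" using w by (simp add: E_step_def)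
  have transfer: "cmod (b k) * (h * real n) ^ p \<le> D * B * M p"
    if "\<And>p t. h ^ p * cmod ((Dop ^^ p) (w n) t) \<le> B * M p" for B p
  proof -
    have "cmod (fourier_coeff (w n) k) * \<bar>of_int k\<bar> ^ p \<le> B * M p / h ^ p"
      using that[of p] h by (intro norm_fourier_coeff_pow_le s) (simp add: field_simps)
    then have *: "cmod (fourier_coeff (w n) k) * (h * real n) ^ p \<le> B * M p"
      using h by (simp add: n power_mult_distrib field_simps)
    have "cmod (b k) * (h * real n) ^ p \<le> D * cmod (fourier_coeff (w n) k) * (h * real n) ^ p"
      using b[of k] h by (intro mult_right_mono) (auto simp: n_def)
    also have "\<dots> \<le> D * (B * M p)" unfolding mult.assoc using * D by (rule mult_left_mono)
    finally show ?thesis by (simp add: mult.assoc)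
  qed
  show "cmod (b k) * (h / H * \<bar>of_int k\<bar>) ^ q \<le> A * (D * C) * M q"
  proof (cases "assoc M (h / H * real n)")
    case (real r0)
    show ?thesis
      unfolding n[symmetric]
    proof (rule absorb_assoc[OF _ _ h real])
      show "cmod (b k) * (h * real n) ^ p \<le> D * C * exp r0 * M p" for p
        using transfer[of "C * exp r0" p] bound[OF real] by (simp add: mult_ac)
    qed auto
  next
    case PInf
    obtain B where B: "smooth_periodic (w n)" "B \<ge> 0" "\<And>p t. h ^ p * cmod ((Dop ^^ p) (w n) t) \<le> B * M p"
      by (rule E_stepD[OF w h]) (rule that)
    \<comment> \<open>\<open>B\<close> depends on \<open>n\<close>, but its mere existence is
      enough: a nonzero \<open>b k\<close> would bound all powers of \<open>h * real n\<close> by a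
      multiple of \<open>M p\<close> and make \<open>assoc M\<close> finite at the smaller point
      \<open>h / H * real n\<close>.\<close>
    have "b k = 0"
    proof (rule ccontr)
      assume "b k \<noteq> 0"
      have "\<bar>h / H * real n\<bar> ^ p \<le> D * B / cmod (b k) * M p" for p
      proof -
        have "\<bar>h / H * real n\<bar> \<le> h * real n"
          using H_ge_1 h mult_right_mono[OF H_ge_1, of "real n"] by (simp add: abs_mult field_simps)
        then have "\<bar>h / H * real n\<bar> ^ p \<le> (h * real n) ^ p" by (intro power_mono) auto
        also have "\<dots> \<le> D * B / cmod (b k) * M p"
          using transfer[OF B(3), of p] \<open>b k \<noteq> 0\<close> by (simp add: field_simps)
        finally show ?thesis .
      qed
      then obtain r where "assoc M (h / H * real n) = ereal r" by (rule assoc_finite)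
      with PInf show False by simp
    qed
    then show ?thesis using A_ge_1 D C M_pos[of q] by simp
  next
    case MInf
    with assoc_nonneg[of "h / H * real n"] show ?thesis by simp
  qed
qed

end

section \<open>Regular sequences\<close>

context weight_M2
begin

text \<open>The constant bound on \<open>z\<close> is absorbed into the growth allowed for
  \<open>g\<close>, since \<open>assoc M\<close> is nonnegative and so \<open>exp r\<close> is at
  least 1.\<close>

lemma decay_bound_sum:
  assumes h: "h > 0" and z: "\<And>n. z n \<in> E_step M h" and g: "\<And>n. g n \<in> E_step M h"
    and C1: "C1 \<ge> 0" "\<And>n. unorm M h (z n) \<le> ennreal C1"
    and C2: "C2 \<ge> 0" "\<And>n r. assoc M (h / H * real n) = ereal r \<Longrightarrow> unorm M h (g n) \<le> ennreal (C2 * exp r)"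
    and b: "\<And>k. cmod (b k) \<le> D * cmod (fourier_coeff (\<lambda>t. z (nat \<bar>k\<bar>) t + g (nat \<bar>k\<bar>) t) k)"
    and D: "D \<ge> 0"
  shows "\<exists>C. decay_bound C (h / H) b"
proof -
  have s: "smooth_periodic (z n)" "smooth_periodic (g n)" for n using z g by (auto simp: E_step_def)
  have "h ^ p * cmod ((Dop ^^ p) (\<lambda>t. z n t + g n t) t) \<le> (C1 + C2) * exp r * M p"
    if r: "assoc M (h / H * real n) = ereal r" for n r p t
  proof -
    have "r \<ge> 0" using assoc_nonneg[of "h / H * real n"] r by simp
    have "h ^ p * cmod ((Dop ^^ p) (z n) t + (Dop ^^ p) (g n) t)
        \<le> h ^ p * (cmod ((Dop ^^ p) (z n) t) + cmod ((Dop ^^ p) (g n) t))"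
      using h by (intro mult_left_mono norm_triangle_ineq) simp
    also have "\<dots> = h ^ p * cmod ((Dop ^^ p) (z n) t) + h ^ p * cmod ((Dop ^^ p) (g n) t)"
      by (rule distrib_left)
    also have "\<dots> \<le> C1 * M p + C2 * exp r * M p"
      using unorm_le_iff[OF s(1) h C1(1)] C1(2) unorm_le_iff[OF s(2) h, of "C2 * exp r"] C2(1) C2(2)[OF r]
      by (intro add_mono) auto
    also have "\<dots> \<le> C1 * exp r * M p + C2 * exp r * M p"
      using \<open>r \<ge> 0\<close> C1(1) M_pos[of p] mult_left_mono[of 1 "exp r" C1]
      by (intro add_mono mult_right_mono) auto
    finally show ?thesis
      using Dop_pow_linear[OF s, of p 1 n 1 n] by (simp add: algebra_simps)
  qed
  moreover have "(\<lambda>t. z n t + g n t) \<in> E_step M h" for n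
    using E_step_linear[OF z g h, of 1 n 1 n] by simp
  ultimately have "decay_bound (A * (D * (C1 + C2))) (h / H) b"
    using C1(1) C2(1) by (intro decay_bound_regular[where w = "\<lambda>n t. z n t + g n t"] h b D) auto
  then show ?thesis by blast
qed

lemma regular_decay:
  assumes g: "g \<in> regular_seqs s M" and z: "z \<in> negligible_seqs s M"
    and b: "\<And>k. cmod (b k) \<le> D * cmod (fourier_coeff (\<lambda>t. z (nat \<bar>k\<bar>) t + g (nat \<bar>k\<bar>) t) k)"
    and D: "D \<ge> 0"
    and R: "s = Roumieu \<Longrightarrow> one_subset M"
  shows "decay s b"
proof (cases s)
  case Beurling
  have H: "H > 0" using H_ge_1 by simp
  have E: "z n \<in> E_step M h" "g n \<in> E_step M h" if "h > 0" for n h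
    using g z that unfolding Beurling by auto
  have "\<exists>\<mu>>0. \<forall>h>0. (SUP n. unorm M h (g n) * eexp (- assoc M (\<mu> * real n))) < \<infinity>"
    using g unfolding Beurling by (simp only: regular_seqs.simps mem_Collect_eq)
  then obtain \<mu> where \<mu>: "\<mu> > 0" "\<forall>h>0. (SUP n. unorm M h (g n) * eexp (- assoc M (\<mu> * real n))) < \<infinity>"
    by (elim exE conjE) (rule that)
  have "\<exists>C. decay_bound C h0 b" if h0: "h0 > 0" for h0
  proof -
    \<comment> \<open>Then \<open>h / H\<close> exceeds both the fixed \<mu> of the regular
      sequence, so that its growth can be absorbed, and the requested scale
      \<open>h0\<close>.\<close>
    define h where "h = H * max \<mu> h0"
    have h: "h > 0" "h / H \<ge> \<mu>" "h / H \<ge> h0" using H h0 by (simp_all add: h_def less_max_iff_disj)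
    obtain C2 where C2: "C2 \<ge> 0" "\<And>n r. assoc M (\<mu> * real n) = ereal r \<Longrightarrow> unorm M h (g n) \<le> ennreal (C2 * exp r)"
      by (rule SUP_eexp_uminus[OF \<mu>(2)[rule_format, OF h(1)]]) (rule that)
    have "(SUP n. unorm M h (z n) * eexp (assoc M (1 * real n))) < \<infinity>"
      using z h(1) unfolding Beurling by (simp only: negligible_seqs.simps mem_Collect_eq zero_less_one)
    then obtain C1 where C1: "C1 \<ge> 0" "\<And>n. unorm M h (z n) \<le> ennreal C1"
      using assoc_nonneg by (rule SUP_eexp_bounded) (rule that)
    have "\<exists>C. decay_bound C (h / H) b"
    proof (rule decay_bound_sum[where z = z and g = g and b = b and D = D, OF h(1) E(1)[OF h(1)] E(2)[OF h(1)] C1 C2(1) _ b D])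
      fix n r assume r: "assoc M (h / H * real n) = ereal r"
      have "\<bar>\<mu> * real n\<bar> \<le> \<bar>h / H * real n\<bar>"
        using mult_right_mono[OF h(2), of "real n"] \<mu>(1) h(1) H by (simp only: abs_mult abs_divide abs_of_pos abs_of_nat)
      then obtain r' where r': "assoc M (\<mu> * real n) = ereal r'" "r' \<le> r"
        by (rule assoc_finite_mono[OF r]) (rule that)
      have "unorm M h (g n) \<le> ennreal (C2 * exp r')" by (rule C2(2)[OF r'(1)])
      also have "\<dots> \<le> ennreal (C2 * exp r)"
        using r'(2) C2(1) by (intro ennreal_leI mult_left_mono) auto
      finally show "unorm M h (g n) \<le> ennreal (C2 * exp r)" .
    qed
    then show ?thesis using decay_bound_antimono h0 h(3) by blast
  qed
  then show ?thesis by (simp add: decay_def Beurling)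
next
  case Roumieu
  have H: "H > 0" using H_ge_1 by simp
  have "\<exists>h>0. \<forall>\<mu>>0. (SUP n. unorm M h (g n) * eexp (- assoc M (\<mu> * real n))) < \<infinity>"
    using g unfolding Roumieu by (simp only: regular_seqs.simps mem_Collect_eq)
  then obtain h1 where h1: "h1 > 0" "\<forall>\<mu>>0. (SUP n. unorm M h1 (g n) * eexp (- assoc M (\<mu> * real n))) < \<infinity>"
    by (elim exE conjE) (rule that)
  have "\<exists>\<mu>>0. \<exists>h>0. (SUP n. unorm M h (z n) * eexp (assoc M (\<mu> * real n))) < \<infinity>"
    using z unfolding Roumieu by (simp only: negligible_seqs.simps mem_Collect_eq)
  then obtain \<mu> h2 where h2: "h2 > 0" "(SUP n. unorm M h2 (z n) * eexp (assoc M (\<mu> * real n))) < \<infinity>"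
    by (elim exE conjE) (rule that)
  have s: "smooth_periodic (z n)" "smooth_periodic (g n)" for n
    using g z E_space_cont(2)[of _ Roumieu] unfolding Roumieu regular_seqs.simps negligible_seqs.simps by blast+
  \<comment> \<open>One scale for both sequences. Regularity holds for every \<mu>, so the weight
    can be taken at exactly \<open>h / H\<close>, the point that \<open>decay_bound_sum\<close>
    refers to.\<close>
  define h where "h = min h1 h2"
  have h: "h > 0" "h \<le> h1" "h \<le> h2" using h1 h2 by (auto simp: h_def)
  have "h / H > 0" using h H by simp
  obtain C2 where C2: "C2 \<ge> 0" "\<And>n r. assoc M (h / H * real n) = ereal r \<Longrightarrow> unorm M h1 (g n) \<le> ennreal (C2 * exp r)"
    by (rule SUP_eexp_uminus[OF h1(2)[rule_format, OF \<open>h / H > 0\<close>]]) (rule that)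
  obtain C1 where C1: "C1 \<ge> 0" "\<And>n. unorm M h2 (z n) \<le> ennreal C1"
    using h2(2) assoc_nonneg by (rule SUP_eexp_bounded) (rule that)
  have "\<exists>C. decay_bound C (h / H) b"
  proof (rule decay_bound_sum[where z = z and g = g and b = b and D = D, OF h(1) _ _ C1(1) _ C2(1) _ b D])
    fix n
    show "unorm M h (z n) \<le> ennreal C1"
      using unorm_mono[OF h(1,3), of "z n"] C1(2)[of n] by (rule order_trans)
    then show "z n \<in> E_step M h"
      using s by (simp add: E_step_def order_le_less_trans)
    \<comment> \<open>The bound at \<open>h / H\<close> is void for large \<open>n\<close> if \<open>assoc M\<close> takes the value \<open>\<infinity>\<close>, hence the
      parameter depending on \<open>n\<close>.\<close>
    obtain C k where Ck: "C > 0" "k > 0" "\<And>p. 1 \<le> C * k ^ p * M p"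
      using R[OF Roumieu] unfolding one_subset_def by blast
    \<comment> \<open>Keeps \<open>\<nu> * real n\<close> below \<open>1 / k\<close>, where
      \<open>one_subset M\<close> makes \<open>assoc M\<close> finite; the \<open>+ 1\<close> covers
      \<open>n = 0\<close>.\<close>
    define \<nu> where "\<nu> = 1 / (k * (real n + 1))"
    have \<nu>: "\<nu> > 0" using Ck(2) by (simp add: \<nu>_def)
    then have "\<bar>\<nu> * real n\<bar> \<le> \<nu> * (real n + 1)" by (simp add: abs_mult)
    also have "\<dots> = 1 / k" by (simp add: \<nu>_def)
    finally have \<nu>n: "\<bar>\<nu> * real n\<bar> \<le> 1 / k" .
    have "\<bar>\<nu> * real n\<bar> ^ p \<le> C * M p" for p
    proof -
      have "\<bar>\<nu> * real n\<bar> ^ p \<le> (1 / k) ^ p" using \<nu>n by (intro power_mono) auto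
      also have "\<dots> \<le> C * M p" using Ck(3)[of p] Ck(2) by (simp add: power_divide field_simps)
      finally show ?thesis .
    qed
    then obtain r where r: "assoc M (\<nu> * real n) = ereal r" by (rule assoc_finite)
    obtain C' where "\<And>n r. assoc M (\<nu> * real n) = ereal r \<Longrightarrow> unorm M h1 (g n) \<le> ennreal (C' * exp r)"
      by (rule SUP_eexp_uminus[OF h1(2)[rule_format, OF \<nu>]]) (rule that)
    from this[OF r] have "unorm M h1 (g n) < \<infinity>" by (simp add: order_le_less_trans)
    with unorm_mono[OF h(1,2), of "g n"] show "g n \<in> E_step M h"
      using s by (simp add: E_step_def order_le_less_trans)
    fix r assume "assoc M (h / H * real n) = ereal r"
    from order_trans[OF unorm_mono[OF h(1,2)] C2(2)[OF this]]
    show "unorm M h (g n) \<le> ennreal (C2 * exp r)" .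
  qed
  then show ?thesis unfolding decay_def Roumieu using \<open>h / H > 0\<close> by auto
qed

text \<open>A single coefficient decays at scale \<open>h\<close> as soon as (h |k|)^q <= C M q for
  all q. This is the growth hypothesis with parameter \<open>l\<close> if h |k| <= 1 / l: in the
  Beurling case \<open>l\<close> is adapted to \<open>h\<close>, in the Roumieu case
  \<open>h\<close> to \<open>l\<close>.\<close>

lemma fexp_in_E_space:
  assumes B: "s = Beurling \<Longrightarrow> one_prec M" and R: "s = Roumieu \<Longrightarrow> one_subset M"
  shows "fexp k \<in> E_space s M"
proof -
  let ?b = "\<lambda>j. if j = k then 1 else 0"
  have "decay_bound C h ?b" if "\<And>q. (h * \<bar>of_int k\<bar>) ^ q \<le> C * M q" for C h
  proof -
    have "0 \<le> C" using that[of 0] M_0 by simp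
    then show ?thesis using that M_pos by (auto simp: decay_bound_def less_imp_le)
  qed
  moreover have "(h * \<bar>of_int k\<bar>) ^ q \<le> C * M q"
    if "h * \<bar>of_int k\<bar> \<le> 1 / l" "h > 0" "l > 0" "\<And>p. 1 \<le> C * l ^ p * M p" for h l C q
  proof -
    have "(h * \<bar>of_int k\<bar>) ^ q \<le> (1 / l) ^ q" using that by (intro power_mono) auto
    also have "\<dots> \<le> C * M q" using that(4)[of q] that(3) by (simp add: power_divide field_simps)
    finally show ?thesis .
  qed
  ultimately have *: "\<exists>C. decay_bound C h ?b"
    if "h * \<bar>of_int k\<bar> \<le> 1 / l" "h > 0" "l > 0" "\<exists>C>0. \<forall>p. 1 \<le> C * l ^ p * M p" for h l
    using that by blast
  have "decay s ?b"
  proof (cases s)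
    case Beurling
    have "\<exists>C. decay_bound C h ?b" if "h > 0" for h
      using B[OF Beurling] that unfolding one_prec_def
      by (intro *[of h "1 / (h * (\<bar>of_int k\<bar> + 1))"]) (auto simp: add_nonneg_pos)
    then show ?thesis by (simp add: decay_def Beurling)
  next
    case Roumieu
    then obtain l where l: "l > 0" "\<exists>C>0. \<forall>p. 1 \<le> C * l ^ p * M p"
      using R unfolding one_subset_def by blast
    define h where "h = 1 / (l * (\<bar>of_int k\<bar> + 1))"
    have pos: "0 < \<bar>real_of_int k\<bar> + 1" by simp
    then have "h > 0" using l(1) by (simp add: h_def)
    then have "h * \<bar>of_int k\<bar> \<le> h * (\<bar>of_int k\<bar> + 1)" by simp
    also have "\<dots> = 1 / l" using l(1) pos by (simp add: h_def)
    finally have "\<exists>C. decay_bound C h ?b" using \<open>h > 0\<close> l by (rule *)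
    with \<open>h > 0\<close> have "\<exists>h>0. \<exists>C. decay_bound C h ?b" by blast
    then show ?thesis by (simp add: decay_def Roumieu)
  qed
  from decay_trig(2)[OF this] have "trig ?b \<in> E_space s M" .
  moreover have "trig ?b = fexp k"
    using trig_eq_sum[of "{k}" ?b] by auto
  ultimately show ?thesis by simp
qed

text \<open>By \<open>fexp_diff\<close>, translation splits each exponential into a scalar and
  \<open>fexp (- k)\<close>; the sum is finite, so linearity of \<open>f\<close> yields the
  formula.\<close>

lemma conv_trig:
  assumes fin: "finite S" "\<And>k. k \<notin> S \<Longrightarrow> c k = 0"
    and f: "\<And>g h a b. g \<in> E_space s M \<Longrightarrow> h \<in> E_space s M \<Longrightarrow>
      f (\<lambda>t. a * g t + b * h t) = a * f g + b * f h"
    and E: "\<And>k. fexp k \<in> E_space s M"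
  shows "conv f (trig c) = trig (\<lambda>k. c k * f (fexp (- k)))"
proof
  fix t
  have zero: "f (\<lambda>u. 0) = 0" "(\<lambda>u. 0) \<in> E_space s M"
    using f[where a = 0 and b = 0, OF E[of 0] E[of 0]]
      E_space_linear[where a = 0 and b = 0, OF E[of 0] E[of 0]] by simp_all
  have sum: "(\<lambda>u. \<Sum>k\<in>S. a k * fexp (- k) u) \<in> E_space s M \<and>
      f (\<lambda>u. \<Sum>k\<in>S. a k * fexp (- k) u) = (\<Sum>k\<in>S. a k * f (fexp (- k)))" if "finite S" for a S
    using that
  proof induction
    case empty
    then show ?case using zero by simp
  next
    case (insert k S)
    note IH = conjunct1[OF insert.IH]
    show ?case
      using insert.IH insert.hyps f[OF E[of "- k"] IH, of "a k" 1]
        E_space_linear[OF E[of "- k"] IH, of "a k" 1] by simp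
  qed
  have "conv f (trig c) t = f (\<lambda>u. \<Sum>k\<in>S. (c k * fexp k t) * fexp (- k) u)"
    by (simp add: conv_def trig_eq_sum[OF fin] fexp_diff mult.assoc)
  also have "\<dots> = (\<Sum>k\<in>S. (c k * fexp k t) * f (fexp (- k)))"
    using sum[OF fin(1), of "\<lambda>k. c k * fexp k t"] by simp
  also have "\<dots> = trig (\<lambda>k. c k * f (fexp (- k))) t"
    by (subst trig_eq_sum[OF fin(1)]) (simp_all add: fin(2) mult_ac)
  finally show "conv f (trig c) t = trig (\<lambda>k. c k * f (fexp (- k))) t" .
qed

text \<open>The seminorms of 0 vanish and 0 times infinity is 0, so infinite weights do no harm.
  This puts a sequence into its own class.\<close>

lemma zero_negligible:
  assumes "(\<lambda>t. 0) \<in> E_space s M" shows "(\<lambda>n t. 0) \<in> negligible_seqs s M"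
proof -
  have s: "smooth_periodic (\<lambda>t. 0)" using E_space_cont(2)[OF assms] .
  have z: "(Dop ^^ p) (\<lambda>t. 0) = (\<lambda>t. 0)" for p
    using Dop_pow_linear[OF s s, of p 0 0] by simp
  have "(SUP n. unorm M h (\<lambda>t. 0) * eexp (assoc M (\<mu> * real n))) < \<infinity>" if "h > 0" for h \<mu>
    using unorm_le_iff[OF s that, of 0] by (simp add: z)
  then show ?thesis
    using assms zero_less_one by (cases s; simp only: negligible_seqs.simps mem_Collect_eq) blast+
qed

end

text \<open>The bound by \<open>R\<close> makes the spectrum of each \<phi> n finite, and uniqueness
  of Fourier coefficients then gives the function. The last property is the normalisation at the
  extreme frequencies |k| = n.\<close>

lemma mollifier_trig:
  assumes "mollifier \<phi>"
  obtains D c where "D \<ge> 0" "\<And>n. \<phi> n = trig (c n)" "\<And>n k. cmod (c n k) \<le> D"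
    "\<And>n. finite {k. c n k \<noteq> 0}" "\<And>k. c (nat \<bar>k\<bar>) k = 1 / (2 * pi)"
proof -
  have s: "\<And>n. smooth_periodic (\<phi> n)"
    and ex: "\<exists>C>0. \<forall>k n. cmod (fourier_coeff (\<phi> n) k) \<le> C"
      "\<exists>R>0. \<forall>n k. real_of_int \<bar>k\<bar> > R * real n \<longrightarrow> fourier_coeff (\<phi> n) k = 0"
    and one: "\<forall>n k. \<bar>k\<bar> \<le> int n \<longrightarrow> fourier_coeff (\<phi> n) k = 1 / (2 * pi)"
    using assms unfolding mollifier_def by simp_all
  obtain D where D: "D > 0" "\<forall>k n. cmod (fourier_coeff (\<phi> n) k) \<le> D"
    using ex(1) by (elim exE conjE) (rule that)
  obtain R where R: "\<forall>n k. real_of_int \<bar>k\<bar> > R * real n \<longrightarrow> fourier_coeff (\<phi> n) k = 0"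
    using ex(2) by (elim exE conjE) (rule that)
  have fin: "finite {k. fourier_coeff (\<phi> n) k \<noteq> 0}" for n
  proof (rule finite_subset)
    show "{k. fourier_coeff (\<phi> n) k \<noteq> 0} \<subseteq> {- \<lfloor>R * real n\<rfloor>..\<lfloor>R * real n\<rfloor>}"
    proof
      fix k assume "k \<in> {k. fourier_coeff (\<phi> n) k \<noteq> 0}"
      then have "real_of_int \<bar>k\<bar> \<le> R * real n" using R by (auto simp: not_less[symmetric])
      then have "\<bar>k\<bar> \<le> \<lfloor>R * real n\<rfloor>" by (simp only: le_floor_iff)
      then show "k \<in> {- \<lfloor>R * real n\<rfloor>..\<lfloor>R * real n\<rfloor>}" by auto
    qed
  qed simp
  have "rapid (fourier_coeff (\<phi> n))" for n
    by (rule rapid_finite_support[OF fin]) simp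
  from trig_fourier_coeff[OF s this] have "\<phi> n = trig (fourier_coeff (\<phi> n))" for n .
  with D(1) fin show ?thesis
    by (intro that[of D "\<lambda>n. fourier_coeff (\<phi> n)"]) (use D(2) one in auto)
qed

section \<open>Cosets, and the theorem\<close>

lemma mem_a_r_coset_seq_ring:
  "x \<in> N +>\<^bsub>seq_ring R\<^esub> f \<longleftrightarrow> (\<exists>z\<in>N. x = (\<lambda>n t. z n t + f n t))"
  by (simp add: a_r_coset_def r_coset_def seq_ring_def)

text \<open>Brings regular classes into the form of \<open>GA_class\<close>, so that the
  intersection compares cosets of one ring.\<close>

lemma carrier_GA_reg:
  "carrier (GA_reg s M) = {negligible_seqs s M +>\<^bsub>seq_ring (moderate s M)\<^esub> g | g. g \<in> regular_seqs s M}"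
proof -
  have "carrier (seq_ring R) = R" for R by (simp add: seq_ring_def)
  then have "carrier (GA_reg s M) = {negligible_seqs s M +>\<^bsub>seq_ring (regular_seqs s M)\<^esub> g | g. g \<in> regular_seqs s M}"
    by (auto simp: GA_reg_def FactRing_def A_RCOSETS_def')
  moreover have "negligible_seqs s M +>\<^bsub>seq_ring (regular_seqs s M)\<^esub> g =
      negligible_seqs s M +>\<^bsub>seq_ring (moderate s M)\<^esub> g" for g
    by (simp add: set_eq_iff mem_a_r_coset_seq_ring)
  ultimately show ?thesis by simp
qed

theorem theorem4:
  fixes M :: "nat \<Rightarrow> real" and s :: kind and \<phi> :: "nat \<Rightarrow> real \<Rightarrow> complex"
  assumes "\<And>p. M p > 0" and "M 0 = 1" and "M1 M" and "M2 M"
    and "s = Beurling \<Longrightarrow> one_prec M"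
    and "s = Roumieu \<Longrightarrow> one_subset M"
    and "mollifier \<phi>"
  shows "carrier (GA_reg s M) \<inter> \<iota> s M \<phi> ` E_dual s M =
         \<iota> s M \<phi> ` (functional_of s M ` E_space s M)"
proof -
  obtain A H where "A \<ge> 1" "H \<ge> 1" "\<And>p q. M (p + q) \<le> A * H ^ (p + q) * M p * M q"
    using \<open>M2 M\<close> unfolding M2_def by blast
  then interpret weight_M2 M A H
    by unfold_locales (use assms(1,2) in auto)
  have E: "fexp k \<in> E_space s M" for k
    using assms(5,6) by (rule fexp_in_E_space)
  have zero: "(\<lambda>n t. 0) \<in> negligible_seqs s M"
    using E_space_linear[where a = 0 and b = 0, OF E[of 0] E[of 0]] by (intro zero_negligible) simp
  obtain D c where D: "D \<ge> 0" "\<And>n k. cmod (c n k) \<le> D" and \<phi>: "\<And>n. \<phi> n = trig (c n)"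
    and fin: "\<And>n. finite {k. c n k \<noteq> 0}" and one: "\<And>k. c (nat \<bar>k\<bar>) k = 1 / (2 * pi)"
    by (rule mollifier_trig[OF assms(7)]) (rule that)
  have conv: "conv f (\<phi> n) = trig (\<lambda>k. c n k * f (fexp (- k)))" if "f \<in> E_dual s M" for f n
    unfolding \<phi> using that by (intro conv_trig[OF fin _ _ E]) (auto simp: E_dual_def)
  have functional: "functional_of s M F (fexp (- k)) = of_real (2 * pi) * fourier_coeff F k" for F k
    using E[of "- k"] by (simp add: functional_of_def fourier_coeff_fexp)
  show ?thesis
  proof (intro equalityI subsetI)
    fix X assume X: "X \<in> carrier (GA_reg s M) \<inter> \<iota> s M \<phi> ` E_dual s M"
    then obtain f g where f: "f \<in> E_dual s M" "X = \<iota> s M \<phi> f"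
      and g: "g \<in> regular_seqs s M" "X = negligible_seqs s M +>\<^bsub>seq_ring (moderate s M)\<^esub> g"
      unfolding carrier_GA_reg by auto
    \<comment> \<open>The sequence represents its own class, which is also that of \<open>g\<close>;
      hence it is \<open>g\<close> plus a negligible \<open>z\<close>.\<close>
    have "(\<lambda>n. conv f (\<phi> n)) \<in> X"
      unfolding f(2) \<iota>_def GA_class_def mem_a_r_coset_seq_ring using zero by force
    then obtain z where z: "z \<in> negligible_seqs s M" "(\<lambda>n. conv f (\<phi> n)) = (\<lambda>n t. z n t + g n t)"
      unfolding g(2) mem_a_r_coset_seq_ring by blast
    define b where "b k = f (fexp (- k))" for k
    have w: "(\<lambda>t. z n t + g n t) = trig (\<lambda>k. c n k * b k)" for n
      using fun_cong[OF z(2), of n] conv[OF f(1), of n] by (simp add: b_def)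
    have "fourier_coeff (\<lambda>t. z n t + g n t) k = c n k * b k" for n k
        unfolding w by (intro fourier_coeff_trig rapid_finite_support[OF fin[of n]]) simp
    \<comment> \<open>The constant \<open>2 * pi\<close> undoes the coefficient
      \<open>1 / (2 * pi)\<close> of the mollifier with index
      \<open>nat \<bar>k\<bar>\<close>.\<close>
    then have "decay s b"
      using one by (intro regular_decay[OF g(1) z(1), of _ "2 * pi"] assms(6))
        (auto simp: norm_mult norm_divide)
    then have decay: "decay s (\<lambda>k. 1 / of_real (2 * pi) * b k)"
      by (rule decay_mult) (rule order_refl)
    \<comment> \<open>The factor compensates the \<open>2 * pi\<close> in \<open>functional\<close>,
      so that \<open>F\<close> acts on the exponentials exactly as \<open>f\<close> does.\<close>
    define F where "F = trig (\<lambda>k. 1 / of_real (2 * pi) * b k)"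
    have F: "F \<in> E_space s M" unfolding F_def by (rule decay_trig[OF decay])
    have "functional_of s M F (fexp (- k)) = f (fexp (- k))" for k
      unfolding functional F_def fourier_coeff_trig[OF decay_trig(1)[OF decay]] by (simp add: b_def)
    then have "conv f (\<phi> n) = conv (functional_of s M F) (\<phi> n)" for n
      by (simp add: conv[OF f(1)] conv[OF functional_of_in_E_dual[OF F]])
    then have "X = \<iota> s M \<phi> (functional_of s M F)" by (simp add: f(2) \<iota>_def)
    with F show "X \<in> \<iota> s M \<phi> ` (functional_of s M ` E_space s M)" by blast
  next
    fix X assume "X \<in> \<iota> s M \<phi> ` (functional_of s M ` E_space s M)"
    then obtain F where F: "F \<in> E_space s M" "X = \<iota> s M \<phi> (functional_of s M F)" by blast
    note dual = functional_of_in_E_dual[OF F(1)]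
    \<comment> \<open>By \<open>functional\<close> these are the values on
      \<open>fexp (- k)\<close>; the mollifier coefficients \<open>c n\<close> act on them as
      bounded multipliers.\<close>
    have "decay s (\<lambda>k. of_real (2 * pi) * fourier_coeff F k)"
      by (rule decay_mult[OF decay_fourier_coeff[OF F(1)]]) (rule order_refl)
    from trig_regular[OF this D(2)] have "(\<lambda>n. conv (functional_of s M F) (\<phi> n)) \<in> regular_seqs s M"
      by (simp add: conv[OF dual] functional)
    then have "X \<in> carrier (GA_reg s M)"
      unfolding carrier_GA_reg F(2) \<iota>_def GA_class_def by blast
    with dual show "X \<in> carrier (GA_reg s M) \<inter> \<iota> s M \<phi> ` E_dual s M"
      using F(2) by blast
  qed
qed

end
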